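(* The functional $\mathcal{B}_\beta$ is strictly convex on $\mathscr{Y}$ with a unique minimizer $\zeta_c$, which is the unique $\zeta\in\mathscr{Y}$ satisfying $$\zeta\Big(\big\{s\in[0,1]:f_{\beta,\xi}(s)=\sup_{0<s'<1}f_{\beta,\xi}(s')\big\}\Big)=1,$$ where, for $s\in(0,1)$, $f_{\beta,\xi}(s)=\int_0^sF_{\beta,\xi}(u)du$ and $$F_{\beta,\xi}(s)=-h^2K(\beta\delta(0);t)^{-2}K'(\beta\delta(0);t)+\xi'(s)+\int_0^sK'(\beta\delta(u);t)\,du,$$ with $\delta(s)=\int_s^1\zeta([0,u])du$.
   Context: Fix integers $L\ge1$, $d\ge0$ and reals $t>0$, $\beta>0$, $h\in\mathbb{R}$. $\Omega=[[1,L]]^d$ is regarded as a graph with periodic boundary conditions (discrete torus), $|\Omega|=L^d$, and $\Delta$ is its graph Laplacian with the sign convention that $\Delta$ is negative semi-definite. For $A\in\mathbb R^{\Omega\times\Omega}$, $\mathrm{tr}(A)=|\Omega|^{-1}\sum_{x\in\Omega}A_{xx}$. $\xi(x)=\sum_{p\ge0}\beta_p^2x^p$ with $\beta_p\ge0$ and $\xi(1+\epsilon)<\infty$ for some $\epsilon>0$. $K(\cdot;t):(0,\infty)\to(0,\infty)$ is the functional inverse of $u\mapsto\mathrm{tr}(uI-t\Delta)^{-1}$, and $K'$ is its derivative in the first argument. $\mathscr{Y}$ is the set of probability measures on $[0,1]$ whose support does not contain $1$. For $\zeta\in\mathscr{Y}$, let $\delta(s)=\int_s^1\zeta([0,u])du$,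 choose $q_*\in(0,1)$ with $\zeta([q_*,1])=0$, and set $$\mathcal{B}_\beta(\zeta)=\frac12\Big(\log\frac{2\pi}{\beta}+\beta h^2K(\beta\delta(0);t)^{-1}+\beta(1-q_* )K(\beta(1-q_* );t)-\frac1{L^d}\log\det\big(K(\beta(1-q_* );t)I-t\Delta\big)+\int_0^{q_*}\beta K(\beta\delta(u);t)du+\beta^2\int_0^1\zeta([0,u])\xi'(u)du\Big),$$ which does not depend on the choice of $q_*$. The function $f_{\beta,\xi}$ is extended to $[0,1]$ by its limits at the endpoints ($f_{\beta,\xi}(0)=0$, $f_{\beta,\xi}(1)=-\infty$). *)

theory Defs
  imports "HOL-Analysis.Analysis" "HOL-Probability.Probability"
    "Jordan_Normal_Form.Determinant" "Jordan_Normal_Form.Gauss_Jordan_Elimination"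
begin

section \<open>The discrete torus and its Laplacian\<close>

text \<open>Points of the box of side \<open>L\<close> in dimension \<open>d\<close> are lists of length \<open>d\<close> over \<open>{1..L}\<close>.
  For \<open>d = 0\<close> the only point is the empty list.\<close>

definition torus :: "nat \<Rightarrow> nat \<Rightarrow> nat list set" where
  "torus L d = {x. length x = d \<and> set x \<subseteq> {1..L}}"

text \<open>Periodic nearest neighbours, as a simple graph: no loops when \<open>L = 1\<close> and no double edges
  when \<open>L = 2\<close>.\<close>

definition torus_adj :: "nat \<Rightarrow> nat \<Rightarrow> nat list \<Rightarrow> nat list \<Rightarrow> bool" where
  "torus_adj L d x y \<longleftrightarrow> x \<in> torus L d \<and> y \<in> torus L d \<and> x \<noteq> y \<and>
     (\<exists>k<d. (\<forall>j<d. j \<noteq> k \<longrightarrow> x ! j = y ! j) \<and>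
            (y ! k mod L = (x ! k + 1) mod L \<or> x ! k mod L = (y ! k + 1) mod L))"

definition laplacian_entry :: "nat \<Rightarrow> nat \<Rightarrow> nat list \<Rightarrow> nat list \<Rightarrow> real" where
  "laplacian_entry L d x y =
     (if x = y then - real (card {z \<in> torus L d. torus_adj L d x z})
      else if torus_adj L d x y then 1 else 0)"

text \<open>\<open>List.n_lists d [1..<Suc L]\<close> lists the points of \<open>torus L d\<close> without repetition; it serves
  only to number the rows and columns of the matrix. Trace and determinant do not depend
  on the numbering.\<close>

definition laplacian :: "nat \<Rightarrow> nat \<Rightarrow> real mat" where
  "laplacian L d = Matrix.mat (L ^ d) (L ^ d)
     (\<lambda>(i, j). laplacian_entry L d (List.n_lists d [1..<Suc L] ! i) (List.n_lists d [1..<Suc L] ! j))"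

definition ntr :: "real mat \<Rightarrow> real" where
  "ntr A = (\<Sum>i<dim_row A. A $$ (i, i)) / real (dim_row A)"

text \<open>The matrix \<open>u I - t \<Delta>\<close>.\<close>

definition massive_laplacian :: "nat \<Rightarrow> nat \<Rightarrow> real \<Rightarrow> real \<Rightarrow> real mat" where
  "massive_laplacian L d t u = u \<cdot>\<^sub>m 1\<^sub>m (L ^ d) - t \<cdot>\<^sub>m laplacian L d"

text \<open>For \<open>u > 0\<close> and \<open>t > 0\<close> the matrix is positive definite, so \<open>mat_inverse\<close> returns its inverse.\<close>

definition resolvent_trace :: "nat \<Rightarrow> nat \<Rightarrow> real \<Rightarrow> real \<Rightarrow> real" where
  "resolvent_trace L d t u = ntr (the (mat_inverse (massive_laplacian L d t u)))"

definition K :: "nat \<Rightarrow> nat \<Rightarrow> real \<Rightarrow> real \<Rightarrow> real" where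
  "K L d t = inv_into {0<..} (resolvent_trace L d t)"

definition K' :: "nat \<Rightarrow> nat \<Rightarrow> real \<Rightarrow> real \<Rightarrow> real" where
  "K' L d t = deriv (K L d t)"

section \<open>The covariance function\<close>

text \<open>The argument \<open>b\<close> is the sequence of coefficients written \<open>\<beta>\<^sub>p\<close> in the literature.\<close>

definition xi :: "(nat \<Rightarrow> real) \<Rightarrow> real \<Rightarrow> real" where
  "xi b x = (\<Sum>p. (b p)\<^sup>2 * x ^ p)"

definition xi' :: "(nat \<Rightarrow> real) \<Rightarrow> real \<Rightarrow> real" where
  "xi' b = deriv (xi b)"

section \<open>Probability measures on the unit interval\<close>

definition msupport :: "'a::topological_space measure \<Rightarrow> 'a set" where
  "msupport \<zeta> = {x \<in> space \<zeta>. \<forall>U. open U \<and> x \<in> U \<longrightarrow> emeasure \<zeta> (U \<inter> space \<zeta>) > 0}"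

definition Ymeas :: "real measure set" where
  "Ymeas = {\<zeta>. prob_space \<zeta> \<and> space \<zeta> = {0..1} \<and>
               sets \<zeta> = sets (restrict_space borel {0..1}) \<and> 1 \<notin> msupport \<zeta>}"

definition mix :: "real \<Rightarrow> 'a measure \<Rightarrow> 'a measure \<Rightarrow> 'a measure" where
  "mix \<theta> \<mu> \<nu> = measure_of (space \<mu>) (sets \<mu>)
     (\<lambda>A. ennreal (1 - \<theta>) * emeasure \<mu> A + ennreal \<theta> * emeasure \<nu> A)"

definition strictly_convex_on_measures :: "'a measure set \<Rightarrow> ('a measure \<Rightarrow> real) \<Rightarrow> bool" where
  "strictly_convex_on_measures S \<Phi> \<longleftrightarrow>
     (\<forall>\<mu>\<in>S. \<forall>\<nu>\<in>S. \<forall>\<theta>. 0 < \<theta> \<and> \<theta> < 1 \<longrightarrow>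
        mix \<theta> \<mu> \<nu> \<in> S \<and> (\<mu> \<noteq> \<nu> \<longrightarrow> \<Phi> (mix \<theta> \<mu> \<nu>) < (1 - \<theta>) * \<Phi> \<mu> + \<theta> * \<Phi> \<nu>))"

section \<open>The functional and the optimality condition\<close>

definition delta :: "real measure \<Rightarrow> real \<Rightarrow> real" where
  "delta \<zeta> s = integral {s..1} (\<lambda>u. measure \<zeta> {0..u})"

definition B_at :: "nat \<Rightarrow> nat \<Rightarrow> real \<Rightarrow> real \<Rightarrow> real \<Rightarrow> (nat \<Rightarrow> real) \<Rightarrow> real \<Rightarrow> real measure \<Rightarrow> real" where
  "B_at L d t \<beta> h b q \<zeta> = 1 / 2 *
     (ln (2 * pi / \<beta>)
      + \<beta> * h\<^sup>2 / K L d t (\<beta> * delta \<zeta> 0)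
      + \<beta> * (1 - q) * K L d t (\<beta> * (1 - q))
      - 1 / real (L ^ d) * ln (Determinant.det (massive_laplacian L d t (K L d t (\<beta> * (1 - q)))))
      + integral {0..q} (\<lambda>u. \<beta> * K L d t (\<beta> * delta \<zeta> u))
      + \<beta>\<^sup>2 * integral {0..1} (\<lambda>u. measure \<zeta> {0..u} * xi' b u))"

text \<open>The value does not depend on the admissible \<open>q\<close> that is chosen.\<close>

definition B_fun :: "nat \<Rightarrow> nat \<Rightarrow> real \<Rightarrow> real \<Rightarrow> real \<Rightarrow> (nat \<Rightarrow> real) \<Rightarrow> real measure \<Rightarrow> real" where
  "B_fun L d t \<beta> h b \<zeta> =
     B_at L d t \<beta> h b (SOME q. 0 < q \<and> q < 1 \<and> measure \<zeta> {q..1} = 0) \<zeta>"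

definition F_fun :: "nat \<Rightarrow> nat \<Rightarrow> real \<Rightarrow> real \<Rightarrow> real \<Rightarrow> (nat \<Rightarrow> real) \<Rightarrow> real measure \<Rightarrow> real \<Rightarrow> real" where
  "F_fun L d t \<beta> h b \<zeta> s =
     - h\<^sup>2 / (K L d t (\<beta> * delta \<zeta> 0))\<^sup>2 * K' L d t (\<beta> * delta \<zeta> 0)
     + xi' b s
     + integral {0..s} (\<lambda>u. K' L d t (\<beta> * delta \<zeta> u))"

text \<open>The integral of \<open>F_fun\<close> from \<open>0\<close> to \<open>s\<close>, extended to \<open>s = 1\<close> by its limit \<open>-\<infinity>\<close>;
  at \<open>s = 0\<close> the integral is already the limit \<open>0\<close>.\<close>

definition f_fun :: "nat \<Rightarrow> nat \<Rightarrow> real \<Rightarrow> real \<Rightarrow> real \<Rightarrow> (nat \<Rightarrow> real) \<Rightarrow> real measure \<Rightarrow> real \<Rightarrow> ereal" where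
  "f_fun L d t \<beta> h b \<zeta> s =
     (if s < 1 then ereal (integral {0..s} (F_fun L d t \<beta> h b \<zeta>)) else - \<infinity>)"

definition concentrated_on_maximizers ::
  "nat \<Rightarrow> nat \<Rightarrow> real \<Rightarrow> real \<Rightarrow> real \<Rightarrow> (nat \<Rightarrow> real) \<Rightarrow> real measure \<Rightarrow> bool" where
  "concentrated_on_maximizers L d t \<beta> h b \<zeta> \<longleftrightarrow>
     measure \<zeta> {s \<in> {0..1}. f_fun L d t \<beta> h b \<zeta> s = (SUP s'\<in>{0<..<1}. f_fun L d t \<beta> h b \<zeta> s')} = 1"

end

theory Submission
  imports Defs "Jordan_Normal_Form.Char_Poly"
begin

text \<open>
  In terms of the eigenvalues \<open>- l\<close> of \<open>t \<Delta>\<close>, the function \<open>K\<close> is the inverse of the mean of the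
  functions \<open>1 / (u + l)\<close> with \<open>l \<ge> 0\<close>, so \<open>K\<close> is strictly convex and \<open>1 / K\<close> is convex. Since the
  tail integral \<open>\<delta>\<close> depends linearly on the measure, the tangents of \<open>K\<close> and \<open>1 / K\<close> give the strict
  inequality
  \<open>B(\<eta>) > B(\<zeta>) + \<beta>\<^sup>2 / 2 (\<integral> f\<^sub>\<zeta> d\<zeta> - \<integral> f\<^sub>\<zeta> d\<eta>)\<close> for \<open>\<eta> \<noteq> \<zeta>\<close>.
  Applied at a mixture it is strict convexity, and applied at a measure concentrated on the maximizers of
  \<open>f\<^sub>\<zeta>\<close> it shows that this measure is the only minimizer, hence the only such measure.

  For existence, minimize \<open>B\<close> by compactness over the measures on \<open>[0, q]\<close>. The same inequality at mixtures
  close to the minimizer \<open>\<zeta>\<close>, towards a Dirac measure at \<open>s\<close>, yields \<open>f\<^sub>\<zeta>(s) \<le> \<integral> f\<^sub>\<zeta> d\<zeta>\<close> for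
  \<open>s \<le> q\<close>. Because \<open>K(x) \<rightarrow> \<infinity>\<close> as \<open>x \<rightarrow> 0\<close>, the derivative of \<open>f\<^sub>\<zeta>\<close> is negative on \<open>[q, 1)\<close> for
  \<open>q\<close> near \<open>1\<close>, uniformly in \<open>\<zeta>\<close>, so the points beyond \<open>q\<close> cannot exceed the maximum.
\<close>

section \<open>The spectrum of the massive Laplacian\<close>

text \<open>\<open>Ymeas\<close> is not closed under weak limits, since mass may drift to 1. This
  forces the minimization onto [0, q], with a cutoff that has to be fixed before the minimizer is
  known; hence the bound on the derivative of \<open>f\<close> near 1 is made uniform over all
  measures. The minimizer on [0, q] turns out to be a global one only afterwards, through
  concentration. Strictness can come only from \<open>K\<close>: the field \<open>h\<close> may
  vanish, \<open>1 / K\<close> is linear when all eigenvalues are 0, and the \<open>xi'\<close> term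
  is linear in the measure. \<open>B\<close> is never differentiated. Convexity gives tangent
  inequalities with an explicit remainder, and the first order condition follows from tangents at
  nearby mixtures together with the continuity of \<open>F\<close> along them. The eigenvalue 0
  matters: it makes the mean resolvent unbounded near 0, hence onto the positive half line, so that
  \<open>K\<close> is a genuine inverse there. Distribution functions may jump, so the integration
  by parts is arranged for a factor that is merely monotone.\<close>

lemma symmetric_eigenvalue_real:
  fixes A :: "real mat" and e :: complex
  assumes A: "A \<in> carrier_mat n n"
    and sym: "\<And>i j. i < n \<Longrightarrow> j < n \<Longrightarrow> A $$ (i, j) = A $$ (j, i)"
    and ev: "eigenvalue (map_mat of_real A) e"
  shows "e = of_real (Re e)"
proof -
  obtain v where v: "v \<in> carrier_vec n" "v \<noteq> 0\<^sub>v n" "map_mat of_real A *\<^sub>v v = e \<cdot>\<^sub>v v"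
    using ev A unfolding eigenvalue_def eigenvector_def by auto
  have comp: "(\<Sum>j<n. of_real (A $$ (i, j)) * v $ j) = e * v $ i" if "i < n" for i
  proof -
    have "(map_mat of_real A *\<^sub>v v) $ i = (\<Sum>j<n. of_real (A $$ (i, j)) * v $ j)"
      using that A v(1) by (auto simp: scalar_prod_def atLeast0LessThan intro!: sum.cong)
    then show ?thesis using v that by simp
  qed
  \<comment> \<open>This is the Hermitian form of \<open>A\<close> at \<open>v\<close>. The
    eigenvalue equation makes it \<open>e\<close> times the squared norm, and symmetry makes it its
    own conjugate, so \<open>e\<close> is real.\<close>
  define S :: complex where "S = (\<Sum>i<n. \<Sum>j<n. of_real (A $$ (i, j)) * (cnj (v $ i) * v $ j))"
  have S1: "S = e * of_real (\<Sum>i<n. (cmod (v $ i))\<^sup>2)"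
  proof -
    have "S = (\<Sum>i<n. cnj (v $ i) * (\<Sum>j<n. of_real (A $$ (i, j)) * v $ j))"
      unfolding S_def by (simp add: sum_distrib_left mult_ac)
    also have "\<dots> = (\<Sum>i<n. cnj (v $ i) * (e * v $ i))"
      by (rule sum.cong) (auto simp: comp)
    also have "\<dots> = (\<Sum>i<n. e * (v $ i * cnj (v $ i)))"
      by (simp add: mult_ac)
    also have "\<dots> = e * of_real (\<Sum>i<n. (cmod (v $ i))\<^sup>2)"
      by (simp add: sum_distrib_left complex_norm_square[symmetric] del: of_real_power)
    finally show ?thesis .
  qed
  have "cnj S = (\<Sum>i<n. \<Sum>j<n. of_real (A $$ (i, j)) * (v $ i * cnj (v $ j)))"
    unfolding S_def by simp
  also have "\<dots> = (\<Sum>j<n. \<Sum>i<n. of_real (A $$ (i, j)) * (v $ i * cnj (v $ j)))"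
    by (rule sum.swap)
  also have "\<dots> = S" unfolding S_def
    by (intro sum.cong refl) (auto simp: sym mult_ac)
  finally have cS: "cnj S = S" .
  obtain k where k: "k < n" "v $ k \<noteq> 0"
    using v(1,2) by (metis eq_vecI index_zero_vec carrier_vecD)
  have "0 < (cmod (v $ k))\<^sup>2" using k by simp
  also have "\<dots> \<le> (\<Sum>i<n. (cmod (v $ i))\<^sup>2)"
    by (rule member_le_sum) (use k in auto)
  finally have pos: "(\<Sum>i<n. (cmod (v $ i))\<^sup>2) \<noteq> 0" by simp
  have "cnj e = e"
  proof -
    have "cnj e * of_real (\<Sum>i<n. (cmod (v $ i))\<^sup>2) = e * of_real (\<Sum>i<n. (cmod (v $ i))\<^sup>2)"
      using cS unfolding S1 complex_cnj_mult complex_cnj_complex_of_real .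
    then show ?thesis using pos unfolding mult_cancel_right of_real_eq_0_iff by blast
  qed
  then show ?thesis by (metis Reals_cnj_iff of_real_Re)
qed

text \<open>Only the trace and the determinant of the resolvent matter below, and both can be read
  off the characteristic polynomial. A list of roots with multiplicity therefore suffices, and no
  eigenbasis is built: the polynomial splits over the complex numbers and its roots are
  real.\<close>

lemma symmetric_char_poly_splits:
  fixes A :: "real mat"
  assumes A: "A \<in> carrier_mat n n"
    and sym: "\<And>i j. i < n \<Longrightarrow> j < n \<Longrightarrow> A $$ (i, j) = A $$ (j, i)"
  obtains es where "length es = n" "char_poly A = (\<Prod>e\<leftarrow>es. [:- e, 1:])"
proof -
  let ?C = "map_mat of_real A :: complex mat"
  have C: "?C \<in> carrier_mat n n" using A by simp
  obtain as where as: "char_poly ?C = (\<Prod>a\<leftarrow>as. [:- a, 1:])" "length as = n"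
    using char_poly_factorized[OF C] by blast
  have re: "a = of_real (Re a)" if "a \<in> set as" for a
  proof (rule symmetric_eigenvalue_real[OF A sym])
    have "poly (char_poly ?C) a = 0"
      unfolding as(1) using that by (induction as) auto
    then show "eigenvalue ?C a" using eigenvalue_root_char_poly[OF C] by simp
  qed
  have "map_poly of_real (\<Prod>e\<leftarrow>map Re as. [:- e, 1:]) = (\<Prod>a\<leftarrow>as. [:- a, 1:] :: complex poly)"
    using re
  proof (induction as)
    case (Cons a as)
    have *: "of_real (Re a) = a" using Cons.prems by simp
    interpret map_poly_comm_ring_hom "of_real :: real \<Rightarrow> complex"
      by unfold_locales auto
    show ?case using Cons * by (simp add: hom_distribs map_poly_pCons)
  qed simp
  also have "\<dots> = map_poly of_real (char_poly A)"
    unfolding as(1)[symmetric] by (rule of_real_hom.char_poly_hom[OF A])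
  finally have "char_poly A = (\<Prod>e\<leftarrow>map Re as. [:- e, 1:])"
    unfolding poly_eq_iff by (simp add: coeff_map_poly)
  then show thesis using that[of "map Re as"] as(2) by simp
qed

text \<open>Jacobi's formula: the trace of the resolvent is the logarithmic derivative of the
  characteristic polynomial. The inverse is the adjugate over the determinant, the diagonal of the
  adjugate consists of principal minors, and \<open>pderiv_char_poly\<close> identifies their sum
  with the derivative.\<close>

lemma trace_inverse_char_poly:
  fixes A M :: "real mat"
  assumes A: "A \<in> carrier_mat n n" and M: "M = u \<cdot>\<^sub>m 1\<^sub>m n - A"
    and nz: "poly (char_poly A) u \<noteq> 0"
  shows "det M = poly (char_poly A) u"
    and "ntr (the (mat_inverse M)) = poly (pderiv (char_poly A)) u / poly (char_poly A) u / real n"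
proof -
  have Mc: "M \<in> carrier_mat n n" unfolding M by (rule minus_carrier_mat[OF A])
  have eq: "poly (char_poly B) u = det (u \<cdot>\<^sub>m 1\<^sub>m k - B)" if "B \<in> carrier_mat k k" for B :: "real mat" and k
  proof -
    have "- char_matrix B u = u \<cdot>\<^sub>m 1\<^sub>m k - B"
      using that by (intro eq_matI) (auto simp: char_matrix_def)
    then show ?thesis using char_poly_matrix[OF that, of u] by simp
  qed
  show d: "det M = poly (char_poly A) u" using eq[OF A] M by simp
  let ?I = "(1 / det M) \<cdot>\<^sub>m adj_mat M"
  have dM: "det M \<noteq> 0" using d nz by simp
  have adj: "adj_mat M \<in> carrier_mat n n" "M * adj_mat M = det M \<cdot>\<^sub>m 1\<^sub>m n"
    "adj_mat M * M = det M \<cdot>\<^sub>m 1\<^sub>m n" using adj_mat[OF Mc] by auto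
  have MI: "M * ?I = 1\<^sub>m n"
    using mult_smult_distrib[OF Mc adj(1), of "1 / det M"] adj dM
    by (intro eq_matI) auto
  have IM: "?I * M = 1\<^sub>m n"
    using mult_smult_assoc_mat[OF adj(1) Mc, of "1 / det M"] adj dM
    by (intro eq_matI) auto
  have "M \<in> Units (ring_mat TYPE(real) n ())"
    using Mc MI IM adj(1) unfolding Units_def ring_mat_def by auto
  then obtain B where B: "mat_inverse M = Some B"
    using mat_inverse(1)[OF Mc, where b = "()"] by (cases "mat_inverse M") auto
  note BB = mat_inverse(2)[OF Mc B]
  have "B = B * (M * ?I)" using BB MI by (metis right_mult_one_mat)
  also have "\<dots> = (B * M) * ?I"
    by (rule assoc_mult_mat[symmetric]) (use BB Mc adj in auto)
  also have "\<dots> = ?I" using BB adj by simp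
  finally have BI: "B = ?I" .
  have "(\<Sum>i<n. B $$ (i, i)) = (\<Sum>i<n. det (mat_delete M i i) / det M)"
    unfolding BI using adj(1) Mc
    by (intro sum.cong) (auto simp: adj_mat_def cofactor_def)
  also have "\<dots> = (\<Sum>i<n. det (mat_delete M i i)) / det M"
    by (simp add: sum_divide_distrib)
  also have "(\<Sum>i<n. det (mat_delete M i i)) = (\<Sum>i<n. poly (char_poly (mat_delete A i i)) u)"
  proof (rule sum.cong[OF refl])
    fix i assume i: "i \<in> {..<n}"
    have c: "mat_delete A i i \<in> carrier_mat (n - 1) (n - 1)"
      using A by (auto simp: mat_delete_def)
    have "mat_delete M i i = u \<cdot>\<^sub>m 1\<^sub>m (n - 1) - mat_delete A i i"
      unfolding M using A i by (intro eq_matI) (auto simp: mat_delete_def)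
    then show "det (mat_delete M i i) = poly (char_poly (mat_delete A i i)) u"
      using eq[OF c] by simp
  qed
  also have "\<dots> = poly (pderiv (char_poly A)) u"
    unfolding pderiv_char_poly[OF A] by (simp add: poly_sum)
  finally have "(\<Sum>i<n. B $$ (i, i)) = poly (pderiv (char_poly A)) u / poly (char_poly A) u"
    using d by simp
  then show "ntr (the (mat_inverse M)) = poly (pderiv (char_poly A)) u / poly (char_poly A) u / real n"
    using BB unfolding ntr_def B by auto
qed

text \<open>A maximum principle. At an index \<open>i\<close> where the eigenvector is largest in
  absolute value, subtracting the vanishing row sum times \<open>v $ i\<close> removes the diagonal
  entry, and what remains is a sum of nonnegative entries times nonpositive factors.\<close>

lemma eigenvalue_nonpos_of_zero_row_sums:
  fixes A :: "real mat"
  assumes A: "A \<in> carrier_mat n n"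
    and off: "\<And>i j. i < n \<Longrightarrow> j < n \<Longrightarrow> i \<noteq> j \<Longrightarrow> A $$ (i, j) \<ge> 0"
    and row: "\<And>i. i < n \<Longrightarrow> (\<Sum>j<n. A $$ (i, j)) = 0"
    and ev: "eigenvalue A e"
  shows "e \<le> 0"
proof -
  obtain v where v: "v \<in> carrier_vec n" "v \<noteq> 0\<^sub>v n" "A *\<^sub>v v = e \<cdot>\<^sub>v v"
    using ev A unfolding eigenvalue_def eigenvector_def by auto
  have comp: "(\<Sum>j<n. A $$ (i, j) * v $ j) = e * v $ i" if "i < n" for i
  proof -
    have "(A *\<^sub>v v) $ i = (\<Sum>j<n. A $$ (i, j) * v $ j)"
      using that A v(1) by (auto simp: scalar_prod_def atLeast0LessThan intro!: sum.cong)
    then show ?thesis using v that by simp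
  qed
  obtain k where k: "k < n" "v $ k \<noteq> 0"
    using v(1,2) by (metis eq_vecI index_zero_vec carrier_vecD)
  define m where "m = Max ((\<lambda>i. \<bar>v $ i\<bar>) ` {..<n})"
  have "m \<in> (\<lambda>i. \<bar>v $ i\<bar>) ` {..<n}" unfolding m_def by (rule Max_in) (use k in auto)
  then obtain i where i: "i < n" "\<bar>v $ i\<bar> = m" by auto
  have mx: "\<bar>v $ j\<bar> \<le> \<bar>v $ i\<bar>" if "j < n" for j
    unfolding i(2) m_def by (rule Max_ge) (use that in auto)
  have vi: "v $ i \<noteq> 0" using mx[OF k(1)] k(2) by auto
  have "e * (v $ i)\<^sup>2 = (\<Sum>j<n. A $$ (i, j) * v $ j) * v $ i - (\<Sum>j<n. A $$ (i, j)) * (v $ i)\<^sup>2"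
    using comp[OF i(1)] row[OF i(1)] by (simp add: power2_eq_square)
  also have "\<dots> = (\<Sum>j<n. A $$ (i, j) * (v $ j * v $ i - (v $ i)\<^sup>2))"
    by (simp add: sum_distrib_right sum_subtractf right_diff_distrib mult.assoc)
  also have "\<dots> \<le> 0"
  proof (rule sum_nonpos)
    fix j assume j: "j \<in> {..<n}"
    have "v $ j * v $ i \<le> \<bar>v $ j\<bar> * \<bar>v $ i\<bar>" by (metis abs_ge_self abs_mult)
    also have "\<dots> \<le> \<bar>v $ i\<bar> * \<bar>v $ i\<bar>" using mx[of j] j by (intro mult_right_mono) auto
    finally have "v $ j * v $ i - (v $ i)\<^sup>2 \<le> 0" by (simp add: power2_eq_square)
    moreover have "j = i \<or> A $$ (i, j) \<ge> 0" using off i j by auto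
    ultimately show "A $$ (i, j) * (v $ j * v $ i - (v $ i)\<^sup>2) \<le> 0"
      by (auto simp: mult_nonneg_nonpos power2_eq_square)
  qed
  finally show ?thesis using vi by (simp add: mult_le_0_iff)
qed

section \<open>Eigenvalues of the Laplacian of the torus\<close>

lemma finite_torus: "finite (torus L d)"
proof -
  have "torus L d = {x. set x \<subseteq> {1..L} \<and> length x = d}" unfolding torus_def by auto
  then show ?thesis using finite_lists_length_eq[of "{1..L}" d] by simp
qed

lemma bij_betw_torus:
  "bij_betw ((!) (List.n_lists d [1..<Suc L])) {..<L ^ d} (torus L d)"
proof -
  let ?xs = "List.n_lists d [1..<Suc L]"
  have "length ?xs = L ^ d" by (simp add: length_n_lists del: upt_Suc)
  moreover have "set ?xs = torus L d" by (auto simp: set_n_lists torus_def simp del: upt_Suc)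
  moreover have "distinct ?xs" by (rule distinct_n_lists) (simp del: upt_Suc)
  ultimately show ?thesis by (metis bij_betw_nth)
qed

lemma laplacian_carrier: "laplacian L d \<in> carrier_mat (L ^ d) (L ^ d)"
  unfolding laplacian_def by simp

lemma torus_adj_sym: "torus_adj L d x y \<longleftrightarrow> torus_adj L d y x"
  unfolding torus_adj_def by metis

text \<open>The diagonal entry is minus the degree and the other entries count the neighbours. The
  fact serves twice: it feeds the maximum principle, and it makes the constant vector an eigenvector
  for 0.\<close>

lemma laplacian_row_sum:
  assumes "i < L ^ d"
  shows "(\<Sum>j<L ^ d. laplacian L d $$ (i, j)) = 0"
proof -
  let ?x = "List.n_lists d [1..<Suc L] ! i"
  have x: "?x \<in> torus L d" using bij_betw_torus assms unfolding bij_betw_def by blast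
  have "(\<Sum>j<L ^ d. laplacian L d $$ (i, j)) =
      (\<Sum>j<L ^ d. laplacian_entry L d ?x (List.n_lists d [1..<Suc L] ! j))"
    using assms by (intro sum.cong) (auto simp: laplacian_def simp del: upt_Suc)
  also have "\<dots> = (\<Sum>y\<in>torus L d. laplacian_entry L d ?x y)"
    by (rule sum.reindex_bij_betw[OF bij_betw_torus])
  also have "\<dots> = laplacian_entry L d ?x ?x + (\<Sum>y\<in>torus L d - {?x}. laplacian_entry L d ?x y)"
    by (rule sum.remove[OF finite_torus x])
  also have "(\<Sum>y\<in>torus L d - {?x}. laplacian_entry L d ?x y) =
      (\<Sum>y\<in>torus L d - {?x}. if torus_adj L d ?x y then 1 else 0)"
    by (rule sum.cong) (auto simp: laplacian_entry_def)
  also have "\<dots> = real (card {y \<in> torus L d - {?x}. torus_adj L d ?x y})"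
    using finite_torus[of L d] by (subst sum.inter_filter[symmetric]) auto
  also have "{y \<in> torus L d - {?x}. torus_adj L d ?x y} = {z \<in> torus L d. torus_adj L d ?x z}"
    by (auto simp: torus_adj_def)
  finally show ?thesis by (simp add: laplacian_entry_def)
qed

lemma pderiv_prod_linear:
  fixes es :: "real list"
  assumes "\<And>e. e \<in> set es \<Longrightarrow> u \<noteq> e"
  shows "poly (\<Prod>e\<leftarrow>es. [:- e, 1:]) u = (\<Prod>e\<leftarrow>es. u - e)"
    and "poly (pderiv (\<Prod>e\<leftarrow>es. [:- e, 1:])) u = (\<Prod>e\<leftarrow>es. u - e) * (\<Sum>e\<leftarrow>es. 1 / (u - e))"
proof -
  show *: "poly (\<Prod>e\<leftarrow>es. [:- e, 1:]) u = (\<Prod>e\<leftarrow>es. u - e)" for es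
    by (induction es) (auto simp: algebra_simps)
  show "poly (pderiv (\<Prod>e\<leftarrow>es. [:- e, 1:])) u = (\<Prod>e\<leftarrow>es. u - e) * (\<Sum>e\<leftarrow>es. 1 / (u - e))"
    using assms
  proof (induction es)
    case (Cons a es)
    have "poly (pderiv (\<Prod>e\<leftarrow>a # es. [:- e, 1:])) u =
      poly (\<Prod>e\<leftarrow>es. [:- e, 1:]) u + (u - a) * poly (pderiv (\<Prod>e\<leftarrow>es. [:- e, 1:])) u"
      unfolding list.map prod_list.Cons pderiv_mult by (simp add: pderiv_pCons algebra_simps)
    also have "\<dots> = (\<Prod>e\<leftarrow>es. u - e) + (u - a) * ((\<Prod>e\<leftarrow>es. u - e) * (\<Sum>e\<leftarrow>es. 1 / (u - e)))"
      using * Cons by simp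
    finally have eq: "poly (pderiv (\<Prod>e\<leftarrow>a # es. [:- e, 1:])) u =
      (\<Prod>e\<leftarrow>es. u - e) + (u - a) * ((\<Prod>e\<leftarrow>es. u - e) * (\<Sum>e\<leftarrow>es. 1 / (u - e)))" .
    have "u - a \<noteq> 0" using Cons.prems by simp
    then show ?case unfolding eq by (simp add: field_simps)
  qed simp
qed

text \<open>All that later parts know about the matrix. The list \<open>ls\<close> holds the
  eigenvalues of minus \<open>t\<close> times the Laplacian, with multiplicity.\<close>

lemma massive_laplacian_spectrum:
  assumes L: "L \<ge> 1" and t: "t > 0"
  obtains ls :: "real list" where
    "length ls = L ^ d" "0 \<in> set ls" "\<And>l. l \<in> set ls \<Longrightarrow> l \<ge> 0"
    "\<And>u. u > 0 \<Longrightarrow> det (massive_laplacian L d t u) = (\<Prod>l\<leftarrow>ls. u + l)"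
    "\<And>u. u > 0 \<Longrightarrow> resolvent_trace L d t u = (\<Sum>l\<leftarrow>ls. 1 / (u + l)) / real (L ^ d)"
proof -
  define n where "n = L ^ d"
  have n: "n > 0" using L unfolding n_def by simp
  define A where "A = t \<cdot>\<^sub>m laplacian L d"
  have A: "A \<in> carrier_mat n n" unfolding A_def n_def using laplacian_carrier by simp
  have ent: "A $$ (i, j) = t * laplacian L d $$ (i, j)" if "i < n" "j < n" for i j
    using that laplacian_carrier[of L d] unfolding A_def n_def by auto
  let ?x = "\<lambda>i. List.n_lists d [1..<Suc L] ! i"
  have lap: "laplacian L d $$ (i, j) = laplacian_entry L d (?x i) (?x j)" if "i < n" "j < n" for i j
    using that unfolding laplacian_def n_def by (simp del: upt_Suc)
  have "\<And>i j. i < n \<Longrightarrow> j < n \<Longrightarrow> A $$ (i, j) = A $$ (j, i)"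
    using torus_adj_sym by (auto simp: ent lap laplacian_entry_def simp del: upt_Suc)
  then obtain es where es: "length es = n" "char_poly A = (\<Prod>e\<leftarrow>es. [:- e, 1:])"
    using symmetric_char_poly_splits[OF A] by metis
  have root: "eigenvalue A e \<longleftrightarrow> e \<in> set es" for e
    unfolding eigenvalue_root_char_poly[OF A] es(2) by (induction es) auto
  have row: "(\<Sum>j<n. A $$ (i, j)) = 0" if "i < n" for i
    using laplacian_row_sum[of i L d] that by (simp add: ent sum_distrib_left[symmetric] n_def)
  have inj: "?x i \<noteq> ?x j" if "i < n" "j < n" "i \<noteq> j" for i j
    using bij_betw_torus[of d L] that unfolding bij_betw_def inj_on_def n_def by blast
  have nonpos: "e \<le> 0" if "e \<in> set es" for e
  proof (rule eigenvalue_nonpos_of_zero_row_sums[OF A _ row])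
    show "eigenvalue A e" using that root by simp
    show "A $$ (i, j) \<ge> 0" if "i < n" "j < n" "i \<noteq> j" for i j
      using that inj[OF that] t by (simp add: ent lap laplacian_entry_def del: upt_Suc)
  qed
  \<comment> \<open>The constant vector puts 0 into the spectrum; \<open>n > 0\<close> is what makes
    it a nonzero vector.\<close>
  have "eigenvector A (vec n (\<lambda>_. 1)) 0"
    unfolding eigenvector_def
  proof (intro conjI)
    have "vec n (\<lambda>_. 1) $ 0 \<noteq> (0\<^sub>v (dim_row A) :: real vec) $ 0" using n A by simp
    then show "vec n (\<lambda>_. 1) \<noteq> (0\<^sub>v (dim_row A) :: real vec)" by metis
    show "A *\<^sub>v vec n (\<lambda>_. 1) = 0 \<cdot>\<^sub>v vec n (\<lambda>_. 1)"
      using A row by (intro eq_vecI) (auto simp: scalar_prod_def atLeast0LessThan)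
  qed (use A in auto)
  then have z: "0 \<in> set es" using root unfolding eigenvalue_def by blast
  show thesis
  proof (rule that[of "map uminus es"])
    show "0 \<in> set (map uminus es)" using z by force
    fix u :: real assume u: "u > 0"
    have ne: "\<And>e. e \<in> set es \<Longrightarrow> u \<noteq> e" using nonpos u by force
    have p: "poly (char_poly A) u \<noteq> 0"
      using ne root eigenvalue_root_char_poly[OF A] by blast
    have M: "massive_laplacian L d t u = u \<cdot>\<^sub>m 1\<^sub>m n - A"
      unfolding massive_laplacian_def A_def n_def ..
    note tr = trace_inverse_char_poly[OF A M p]
    have pr: "(\<Prod>l\<leftarrow>map uminus es. u + l) = (\<Prod>e\<leftarrow>es. u - e)"
      by (simp add: comp_def)
    show "det (massive_laplacian L d t u) = (\<Prod>l\<leftarrow>map uminus es. u + l)"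
      unfolding pr tr(1) es(2) by (rule pderiv_prod_linear(1)[OF ne])
    have "poly (pderiv (char_poly A)) u / poly (char_poly A) u = (\<Sum>e\<leftarrow>es. 1 / (u - e))"
      using p pderiv_prod_linear[OF ne] unfolding es(2) by auto
    then show "resolvent_trace L d t u = (\<Sum>l\<leftarrow>map uminus es. 1 / (u + l)) / real (L ^ d)"
      unfolding resolvent_trace_def tr(2) by (simp add: comp_def n_def)
  qed (use es nonpos n_def in auto)
qed

section \<open>Convexity properties of the inverse of a mean resolvent\<close>

definition mean_resolvent :: "real list \<Rightarrow> real \<Rightarrow> real" where
  "mean_resolvent ls u = (\<Sum>l\<leftarrow>ls. 1 / (u + l)) / real (length ls)"

definition mean_resolvent_deriv :: "real list \<Rightarrow> real \<Rightarrow> real" where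
  "mean_resolvent_deriv ls u = - (\<Sum>l\<leftarrow>ls. 1 / (u + l)\<^sup>2) / real (length ls)"

lemma DERIV_sum_list_inverse:
  fixes u :: real
  assumes "\<And>l. l \<in> set ls \<Longrightarrow> u + l \<noteq> 0"
  shows "((\<lambda>u. \<Sum>l\<leftarrow>ls. 1 / (u + l)) has_real_derivative - (\<Sum>l\<leftarrow>ls. 1 / (u + l)\<^sup>2)) (at u)"
  using assms
proof (induction ls)
  case (Cons a ls)
  have "((\<lambda>u. 1 / (u + a)) has_real_derivative - (1 / (u + a)\<^sup>2)) (at u)"
    using Cons.prems[of a] by (auto intro!: derivative_eq_intros simp: power2_eq_square)
  from DERIV_add[OF this Cons.IH] Cons.prems show ?case by simp
qed simp

lemma DERIV_sum_list_ln:
  fixes u :: real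
  assumes "\<And>l. l \<in> set ls \<Longrightarrow> u + l > 0"
  shows "((\<lambda>u. \<Sum>l\<leftarrow>ls. ln (u + l)) has_real_derivative (\<Sum>l\<leftarrow>ls. 1 / (u + l))) (at u)"
  using assms
proof (induction ls)
  case (Cons a ls)
  have "((\<lambda>u. ln (u + a)) has_real_derivative (1 / (u + a))) (at u)"
    using Cons.prems[of a] by (auto intro!: derivative_eq_intros)
  from DERIV_add[OF this Cons.IH] Cons.prems show ?case by simp
qed simp

lemma sum_list_less:
  fixes f g :: "'a \<Rightarrow> real"
  assumes "xs \<noteq> []" "\<And>x. x \<in> set xs \<Longrightarrow> f x < g x"
  shows "(\<Sum>x\<leftarrow>xs. f x) < (\<Sum>x\<leftarrow>xs. g x)"
  using assms by (induction xs rule: list_nonempty_induct) (auto intro: add_strict_mono)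

text \<open>\<open>k\<close> is any positive right inverse, which is what \<open>inv_into\<close>
  supplies once surjectivity is known. That it is also a left inverse is derived from strict
  monotonicity of the mean resolvent.\<close>

locale resolvent_inverse =
  fixes ls :: "real list" and k :: "real \<Rightarrow> real"
  assumes nonempty: "ls \<noteq> []"
    and nonneg: "\<And>l. l \<in> set ls \<Longrightarrow> l \<ge> 0"
    and pos: "\<And>x. x > 0 \<Longrightarrow> k x > 0"
    and right_inverse: "\<And>x. x > 0 \<Longrightarrow> mean_resolvent ls (k x) = x"
begin

abbreviation "N \<equiv> real (length ls)"
abbreviation "R \<equiv> mean_resolvent ls"
abbreviation "R' \<equiv> mean_resolvent_deriv ls"

definition k' :: "real \<Rightarrow> real" where "k' x = 1 / R' (k x)"

lemma N_pos: "N > 0"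
  using nonempty by simp

lemma shift_pos: "u > 0 \<Longrightarrow> l \<in> set ls \<Longrightarrow> u + l > 0"
  using nonneg by (simp add: add_pos_nonneg)

lemma DERIV_R: "u > 0 \<Longrightarrow> (R has_real_derivative R' u) (at u)"
  unfolding mean_resolvent_def[abs_def] mean_resolvent_deriv_def
  by (intro DERIV_cdivide DERIV_sum_list_inverse) (use shift_pos in force)

lemma R'_neg:
  assumes "u > 0"
  shows "R' u < 0"
proof -
  have "(\<Sum>l\<leftarrow>ls. 0) < (\<Sum>l\<leftarrow>ls. 1 / (u + l)\<^sup>2)"
    using shift_pos[OF assms] by (intro sum_list_less nonempty) force
  then show ?thesis using N_pos unfolding mean_resolvent_deriv_def
    by (simp add: divide_neg_pos sum_list_triv)
qed

text \<open>Each summand \<open>1 / (u + l)\<close> is strictly convex; its distance from the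
  tangent is an explicit square over a positive quantity.\<close>

lemma R_tangent_less:
  assumes u: "u > 0" and v: "v > 0" and ne: "u \<noteq> v"
  shows "R v > R u + R' u * (v - u)"
proof -
  have "(\<Sum>l\<leftarrow>ls. 1 / (u + l) - (v - u) * (1 / (u + l)\<^sup>2)) < (\<Sum>l\<leftarrow>ls. 1 / (v + l))"
  proof (rule sum_list_less[OF nonempty])
    fix l assume l: "l \<in> set ls"
    define A C where "A = u + l" and "C = v + l"
    have AC: "A > 0" "C > 0" "A \<noteq> C" using shift_pos l u v ne by (auto simp: A_def C_def)
    have "1 / C - (1 / A - (C - A) * (1 / A\<^sup>2)) = (C - A)\<^sup>2 / (A\<^sup>2 * C)"
      using AC by (simp add: field_simps power2_eq_square)
    also have "\<dots> > 0" using AC by simp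
    finally show "1 / (u + l) - (v - u) * (1 / (u + l)\<^sup>2) < 1 / (v + l)"
      by (simp add: A_def C_def)
  qed
  then have "(\<Sum>l\<leftarrow>ls. 1 / (u + l)) - (v - u) * (\<Sum>l\<leftarrow>ls. 1 / (u + l)\<^sup>2) < (\<Sum>l\<leftarrow>ls. 1 / (v + l))"
    by (simp only: sum_list_subtractf sum_list_const_mult)
  from divide_strict_right_mono[OF this N_pos] show ?thesis
    unfolding mean_resolvent_def mean_resolvent_deriv_def by (simp add: diff_divide_distrib mult.commute)
qed

lemma R_strict_antimono:
  assumes "0 < u" "u < v"
  shows "R v < R u"
proof -
  have "R u > R v + R' v * (u - v)" using R_tangent_less[of v u] assms by simp
  moreover have "R' v * (u - v) > 0" using R'_neg[of v] assms by (intro mult_neg_neg) auto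
  ultimately show ?thesis by simp
qed

lemma left_inverse:
  assumes "u > 0"
  shows "R u > 0" "k (R u) = u"
proof -
  have "(\<Sum>l\<leftarrow>ls. 0) < (\<Sum>l\<leftarrow>ls. 1 / (u + l))"
    using shift_pos[OF assms] by (intro sum_list_less nonempty) force
  then show p: "R u > 0" using N_pos unfolding mean_resolvent_def by (simp add: sum_list_triv)
  have "R (k (R u)) = R u" using right_inverse p by simp
  then show "k (R u) = u"
    using R_strict_antimono[of u "k (R u)"] R_strict_antimono[of "k (R u)" u] pos[OF p] assms
    by (cases u "k (R u)" rule: linorder_cases) auto
qed

lemma DERIV_k:
  assumes x: "x > 0"
  shows "(k has_real_derivative k' x) (at x)"
proof -
  have "isCont k (R (k x))"
    \<comment> \<open>A neighbourhood of \<open>k x\<close> inside the positive half line, where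
      \<open>R\<close> is continuous and \<open>k\<close> is its left inverse.\<close>
    by (rule isCont_inverse_function2[where f = R and a = "k x / 2" and b = "2 * k x"])
      (use pos[OF x] left_inverse in \<open>force intro: DERIV_isCont[OF DERIV_R]\<close>)+
  then have c: "isCont k x" using right_inverse x by simp
  have "DERIV k x :> inverse (R' (k x))"
    by (rule DERIV_inverse_function[where f = R and g = k and x = x and a = 0 and b = "x + 1", OF DERIV_R[OF pos[OF x]]])
      (use x R'_neg[OF pos[OF x]] right_inverse c in auto)
  then show ?thesis by (simp add: k'_def inverse_eq_divide)
qed

lemma deriv_k: "x > 0 \<Longrightarrow> deriv k x = k' x"
  using DERIV_k by (rule DERIV_imp_deriv)

lemma k'_neg: "x > 0 \<Longrightarrow> k' x < 0"
  unfolding k'_def using R'_neg pos by (simp add: divide_neg_neg)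

lemma continuous_on_k: "continuous_on {0<..} k"
  by (rule DERIV_continuous_on) (use DERIV_k in \<open>auto intro: has_field_derivative_at_within\<close>)

lemma continuous_on_k': "continuous_on {0<..} k'"
proof -
  \<comment> \<open>The induction runs over a separate list \<open>xs\<close>, because
    \<open>ls\<close> is fixed together with \<open>k\<close>.\<close>
  have "continuous_on {0<..} (\<lambda>x. \<Sum>l\<leftarrow>xs. 1 / (k x + l)\<^sup>2)" if "set xs \<subseteq> set ls" for xs
    using that
  proof (induction xs)
    case (Cons a xs)
    have "k x + a \<noteq> 0" if "x > 0" for x using shift_pos[of "k x" a] pos[OF that] Cons.prems by auto
    then show ?case using Cons
      by (auto intro!: continuous_intros continuous_on_k)
  qed auto
  moreover have "\<forall>x\<in>{0<..}. R' (k x) \<noteq> 0" using R'_neg pos by force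
  ultimately show ?thesis
    unfolding k'_def mean_resolvent_deriv_def
    by (intro continuous_intros) (use N_pos in auto)
qed

text \<open>The inverse of a decreasing strictly convex function is strictly convex: take the
  tangent of \<open>R\<close> at \<open>k x\<close>, evaluate it at \<open>k y\<close>, and divide
  by the negative slope.\<close>

lemma k_tangent_less:
  assumes x: "x > 0" and y: "y > 0" and ne: "x \<noteq> y"
  shows "k y > k x + k' x * (y - x)"
proof -
  have "k x \<noteq> k y" using right_inverse x y ne by metis
  then have "y > x + R' (k x) * (k y - k x)"
    using R_tangent_less[of "k x" "k y"] pos right_inverse x y by simp
  then have "(y - x) / R' (k x) < k y - k x"
    using R'_neg[OF pos[OF x]] by (simp add: neg_divide_less_eq mult.commute)
  then show ?thesis by (simp add: k'_def)
qed

lemma k_tangent_le: "x > 0 \<Longrightarrow> y > 0 \<Longrightarrow> k y \<ge> k x + k' x * (y - x)"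
  using k_tangent_less[of x y] by (cases "x = y") auto

lemma k'_mono:
  assumes "0 < x" "x \<le> y"
  shows "k' x \<le> k' y"
proof (cases "x = y")
  case False
  have "k' x * (y - x) \<le> k' y * (y - x)"
    using k_tangent_le[of x y] k_tangent_le[of y x] assms by (simp add: algebra_simps)
  then show ?thesis using False assms by simp
qed simp

text \<open>In the variable \<open>w = 1 / u\<close> the summand \<open>1 / (u + l)\<close> is
  \<open>w / (1 + l * w)\<close>, which is increasing and concave for \<open>l \<ge> 0\<close>.
  Hence the mean resolvent is an increasing concave function of \<open>w\<close>, and its inverse
  \<open>1 / k\<close> is convex. The remainder carries the factor \<open>l\<close>, so for zero
  eigenvalues there is equality and nothing strict can be claimed.\<close>

lemma inverse_k_tangent_le:
  assumes x: "x > 0" and y: "y > 0"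
  shows "1 / k y \<ge> 1 / k x + - k' x / (k x)\<^sup>2 * (y - x)"
proof -
  define a c where "a = k x" and "c = k y"
  have ac: "a > 0" "c > 0" using pos x y by (auto simp: a_def c_def)
  \<comment> \<open>The coefficient \<open>a * (a - c) / c\<close> is \<open>1 / c - 1 / a\<close>,
    the increment of \<open>w\<close>, times the factor \<open>a\<^sup>2\<close> from the change of
    variable.\<close>
  have "(\<Sum>l\<leftarrow>ls. 1 / (c + l)) \<le> (\<Sum>l\<leftarrow>ls. 1 / (a + l) + a * (a - c) / c * (1 / (a + l)\<^sup>2))"
  proof (rule sum_list_mono)
    fix l assume l: "l \<in> set ls"
    have p: "a + l > 0" "c + l > 0" "l \<ge> 0" using shift_pos l ac nonneg by auto
    have "1 / (a + l) + a * (a - c) / c * (1 / (a + l)\<^sup>2) - 1 / (c + l) =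
        l * (a - c)\<^sup>2 / (c * (a + l)\<^sup>2 * (c + l))"
      using p ac by (simp add: divide_simps) (simp add: power2_eq_square algebra_simps)
    also have "\<dots> \<ge> 0" using p ac by simp
    finally show "1 / (c + l) \<le> 1 / (a + l) + a * (a - c) / c * (1 / (a + l)\<^sup>2)" by simp
  qed
  also have "\<dots> = (\<Sum>l\<leftarrow>ls. 1 / (a + l)) + a * (a - c) / c * (\<Sum>l\<leftarrow>ls. 1 / (a + l)\<^sup>2)"
    by (simp only: sum_list_addf sum_list_const_mult)
  finally have "R c \<le> ((\<Sum>l\<leftarrow>ls. 1 / (a + l)) + a * (a - c) / c * (\<Sum>l\<leftarrow>ls. 1 / (a + l)\<^sup>2)) / N"
    unfolding mean_resolvent_def by (rule divide_right_mono) simp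
  then have "R c \<le> R a - a * (a - c) / c * R' a"
    unfolding mean_resolvent_def mean_resolvent_deriv_def by (simp add: add_divide_distrib)
  then have le: "y - x \<le> a * (a - c) / c * (- R' a)"
    using right_inverse x y by (simp add: a_def c_def)
  have neg: "- R' a > 0" using R'_neg ac by simp
  have "(y - x) / (a\<^sup>2 * (- R' a)) \<le> a * (a - c) / c * (- R' a) / (a\<^sup>2 * (- R' a))"
    using le neg by (intro divide_right_mono mult_nonneg_nonneg) auto
  also have "\<dots> = 1 / c - 1 / a" using ac neg by (simp add: field_simps power2_eq_square)
  finally show ?thesis by (simp add: a_def c_def k'_def mult.commute)
qed

text \<open>The slopes of the convex function \<open>1 / k\<close> increase: add its tangent
  inequalities at \<open>x\<close> and at \<open>y\<close>.\<close>

lemma inverse_k_deriv_mono: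
  assumes "0 < x" "x \<le> y"
  shows "- k' x / (k x)\<^sup>2 \<le> - k' y / (k y)\<^sup>2"
proof (cases "x = y")
  case False
  have "- k' x / (k x)\<^sup>2 * (y - x) \<le> - k' y / (k y)\<^sup>2 * (y - x)"
  proof -
    have "p * (y - x) \<le> q * (y - x)" if "b \<ge> a + p * (y - x)" "a \<ge> b + q * (x - y)" for a b p q :: real
      using that by (simp add: algebra_simps)
    from this[OF inverse_k_tangent_le inverse_k_tangent_le] show ?thesis using assms by simp
  qed
  then show ?thesis by (rule mult_right_le_imp_le) (use False assms in simp)
qed simp

text \<open>The quantitative form of the blow-up of \<open>k\<close> at 0. No eigenvalue exceeds the
  sum of all of them, so replacing each by that sum only lowers the mean resolvent.\<close>

lemma k_lower_bound:
  assumes x: "x > 0"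
  shows "k x \<ge> 1 / x - sum_list ls"
proof -
  let ?M = "sum_list ls"
  have M: "l \<le> ?M" if "l \<in> set ls" for l
    using member_le_sum_list[of l ls] that nonneg by (induction ls) (auto simp: sum_list_nonneg add_increasing add_increasing2)
  have M0: "?M \<ge> 0" using nonneg by (rule sum_list_nonneg)
  have "(\<Sum>l\<leftarrow>ls. 1 / (k x + ?M)) \<le> (\<Sum>l\<leftarrow>ls. 1 / (k x + l))"
    by (rule sum_list_mono) (use M shift_pos pos[OF x] in \<open>auto intro!: divide_left_mono mult_pos_pos add_pos_nonneg M0 simp: nonneg\<close>)
  then have "1 / (k x + ?M) \<le> R (k x)"
    using N_pos unfolding mean_resolvent_def by (simp add: sum_list_triv field_simps)
  then have "1 / (k x + ?M) \<le> x" using right_inverse x by simp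
  then show ?thesis using x pos[OF x] M0 by (simp add: field_simps)
qed

text \<open>An envelope argument: \<open>k x\<close> is the critical point of \<open>x * u\<close>
  minus the mean of \<open>ln (u + l)\<close> as a function of \<open>u\<close>, so the terms with
  \<open>k'\<close> cancel. This is why the value of the functional does not depend on the
  cutoff.\<close>

lemma DERIV_legendre:
  assumes x: "x > 0"
  shows "((\<lambda>x. x * k x - (\<Sum>l\<leftarrow>ls. ln (k x + l)) / N) has_real_derivative k x) (at x)"
proof -
  have "((\<lambda>x. \<Sum>l\<leftarrow>ls. ln (k x + l)) has_real_derivative (\<Sum>l\<leftarrow>ls. 1 / (k x + l)) * k' x) (at x)"
    by (rule DERIV_chain2[OF DERIV_sum_list_ln DERIV_k[OF x]]) (use shift_pos pos[OF x] in auto)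
  then have "((\<lambda>x. x * k x - (\<Sum>l\<leftarrow>ls. ln (k x + l)) / N) has_real_derivative
      (1 * k x + k' x * x) - (\<Sum>l\<leftarrow>ls. 1 / (k x + l)) * k' x / N) (at x)"
    by (intro DERIV_diff DERIV_mult DERIV_ident DERIV_k[OF x] DERIV_cdivide)
  moreover have "(\<Sum>l\<leftarrow>ls. 1 / (k x + l)) * k' x / N = x * k' x"
    using right_inverse[OF x] unfolding mean_resolvent_def by (metis times_divide_eq_left)
  ultimately show ?thesis by (simp add: mult.commute)
qed

end

text \<open>Intermediate values. At \<open>1 / x\<close> every summand is at most \<open>x\<close>;
  at \<open>1 / (N * x)\<close> the eigenvalue 0 alone already contributes \<open>N * x\<close> to
  the sum.\<close>

lemma mean_resolvent_surj:
  assumes "0 \<in> set ls" "\<And>l. l \<in> set ls \<Longrightarrow> l \<ge> 0" and x: "x > 0"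
  shows "\<exists>u>0. mean_resolvent ls u = x"
proof -
  define N where "N = real (length ls)"
  have N: "N \<ge> 1" using assms(1) unfolding N_def by (cases ls) auto
  have up: "mean_resolvent ls (1 / x) \<le> x"
  proof -
    have "(\<Sum>l\<leftarrow>ls. 1 / (1 / x + l)) \<le> (\<Sum>l\<leftarrow>ls. x)"
    proof (rule sum_list_mono)
      fix l assume "l \<in> set ls"
      then have "l \<ge> 0" using assms by simp
      then have "1 / (1 / x + l) \<le> 1 / (1 / x)" using x by (intro divide_left_mono) (auto intro!: mult_pos_pos divide_pos_pos add_pos_nonneg)
      then show "1 / (1 / x + l) \<le> x" by simp
    qed
    also have "\<dots> = x * N" by (simp add: sum_list_triv N_def)
    finally show ?thesis using N unfolding mean_resolvent_def N_def[symmetric] by (simp add: pos_divide_le_eq)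
  qed
  have lo: "x \<le> mean_resolvent ls (1 / (N * x))"
  proof -
    have "1 / (u + 0) \<le> (\<Sum>l\<leftarrow>ls. 1 / (u + l))" if "u > 0" for u :: real
      by (rule member_le_sum_list) (use assms that in \<open>auto intro!: image_eqI[of _ _ 0]\<close>)
    from this[of "1 / (N * x)"] have "N * x \<le> (\<Sum>l\<leftarrow>ls. 1 / (1 / (N * x) + l))" using N x by simp
    then show ?thesis using N unfolding mean_resolvent_def N_def[symmetric] by (simp add: pos_le_divide_eq mult.commute)
  qed
  have "continuous_on {1 / (N * x)..1 / x} (mean_resolvent ls)"
    unfolding mean_resolvent_def[abs_def]
  proof (rule DERIV_continuous_on, rule has_field_derivative_at_within, rule DERIV_cdivide, rule DERIV_sum_list_inverse)
    fix u l assume u: "u \<in> {1 / (N * x)..1 / x}" and l: "l \<in> set ls"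
    have "0 < 1 / (N * x)" using N x by simp
    also have "\<dots> \<le> u" using u by simp
    finally show "u + l \<noteq> 0" using assms(2)[OF l] by linarith
  qed
  moreover have "1 / (N * x) \<le> 1 / x" using N x by (intro divide_left_mono) auto
  ultimately obtain u where "1 / (N * x) \<le> u" "mean_resolvent ls u = x"
    using IVT2'[of "mean_resolvent ls" "1 / x" x "1 / (N * x)"] up lo by blast
  moreover have "1 / (N * x) > 0" using N x by simp
  ultimately show ?thesis by (metis less_le_trans)
qed

section \<open>Distribution functions on the unit interval\<close>

text \<open>The second mean value theorem is called only for the integrability that it asserts along
  with the value. No continuity of the monotone factor enters, so distribution functions with atoms
  are covered.\<close>

lemma mono_on_mult_integrable:
  fixes g \<phi> :: "real \<Rightarrow> real"
  assumes "mono_on {a..b} g" "continuous_on {a..b} \<phi>"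
  shows "(\<lambda>u. g u * \<phi> u) integrable_on {a..b}"
proof (cases "a \<le> b")
  case True
  obtain c where "((\<lambda>x. g x * \<phi> x) has_integral (g a * integral {a..c} \<phi> + g b * integral {c..b} \<phi>)) {a..b}"
  proof (rule second_mean_value_theorem_full[OF integrable_continuous_real[OF assms(2)] True, of g])
    show "g x \<le> g y" if "a \<le> x" "x \<le> y" "y \<le> b" for x y
      using mono_onD[OF assms(1), of x y] that by auto
  qed
  then show ?thesis by blast
qed (simp add: integrable_on_empty)

lemma mono_on_integrable:
  fixes g :: "real \<Rightarrow> real"
  assumes "mono_on {a..b} g"
  shows "g integrable_on {a..b}"
  using mono_on_mult_integrable[OF assms continuous_on_const[of _ 1]] by simp

text \<open>The difference of the two sides, as a function of the right end point, changes by at most a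
  multiple of \<open>(v - u)\<^sup>2\<close> between \<open>u\<close> and \<open>v\<close>; this needs no regularity of the monotone factor.\<close>

lemma integral_mult_tail_mono:
  fixes g \<kappa> :: "real \<Rightarrow> real"
  assumes q: "0 \<le> q" and g: "mono_on {0..q} g" and g1: "\<And>u. u \<in> {0..q} \<Longrightarrow> \<bar>g u\<bar> \<le> 1"
    and \<kappa>: "continuous_on {0..q} \<kappa>"
  shows "integral {0..q} (\<lambda>u. \<kappa> u * integral {u..q} g) = integral {0..q} (\<lambda>v. g v * integral {0..v} \<kappa>)"
proof -
  define D where "D u = integral {u..q} g" for u
  define P where "P u = integral {0..u} \<kappa>" for u
  have sub: "mono_on {a..b} g" "continuous_on {a..b} \<kappa>" if "0 \<le> a" "b \<le> q" for a b
    using that mono_on_subset[OF g, of "{a..b}"] continuous_on_subset[OF \<kappa>, of "{a..b}"] by auto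
  have gi: "g integrable_on {a..b}" if "0 \<le> a" "b \<le> q" for a b
    using sub[OF that] mono_on_integrable by blast
  have \<kappa>i: "\<kappa> integrable_on {a..b}" if "0 \<le> a" "b \<le> q" for a b
    using sub[OF that] integrable_continuous_real by blast
  obtain C where C: "\<And>u. u \<in> {0..q} \<Longrightarrow> \<bar>\<kappa> u\<bar> \<le> C"
    using compact_imp_bounded[OF compact_continuous_image[OF \<kappa> compact_Icc]]
    unfolding bounded_iff by (metis imageI real_norm_def)
  have C0: "C \<ge> 0" using C[of 0] q by force
  have bnd: "\<bar>integral {a..b} f\<bar> \<le> B * (b - a)"
    if "a \<le> b" "f integrable_on {a..b}" "\<And>u. u \<in> {a..b} \<Longrightarrow> \<bar>f u\<bar> \<le> B" for a b B and f :: "real \<Rightarrow> real"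
  proof -
    have "norm (integral {a..b} f) \<le> integral {a..b} (\<lambda>_. B)"
      by (rule integral_norm_bound_integral) (use that in auto)
    then show ?thesis using that(1) by (simp add: mult.commute)
  qed
  have Dsplit: "D u = integral {u..v} g + D v" if "0 \<le> u" "u \<le> v" "v \<le> q" for u v
    unfolding D_def using that gi by (intro Henstock_Kurzweil_Integration.integral_combine[symmetric]) auto
  have Psplit: "P v = P u + integral {u..v} \<kappa>" if "0 \<le> u" "u \<le> v" "v \<le> q" for u v
    unfolding P_def using that \<kappa>i by (intro Henstock_Kurzweil_Integration.integral_combine[symmetric]) auto
  have Dc: "continuous_on {0..q} D" unfolding D_def by (rule indefinite_integral_continuous_1'[OF gi]) auto
  have Pc: "continuous_on {0..q} P" unfolding P_def by (rule indefinite_integral_continuous_1[OF \<kappa>i]) auto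
  have i1: "(\<lambda>u. \<kappa> u * D u) integrable_on {a..b}" if "0 \<le> a" "b \<le> q" for a b
    by (rule integrable_continuous_real, rule continuous_on_subset[of "{0..q}"])
      (use that in \<open>auto intro!: continuous_intros \<kappa> Dc\<close>)
  have i2: "(\<lambda>u. g u * P u) integrable_on {a..b}" if "0 \<le> a" "b \<le> q" for a b
    using that by (intro mono_on_mult_integrable sub continuous_on_subset[OF Pc]) auto
  \<comment> \<open>Subtracting \<open>P s * D s\<close> turns the tails up to \<open>q\<close>
    inside the first integral into tails up to \<open>s\<close>. The correction vanishes at both
    ends: \<open>P 0 = 0\<close> and \<open>D q = 0\<close>.\<close>
  define H where "H s = integral {0..s} (\<lambda>u. \<kappa> u * D u) - P s * D s - integral {0..s} (\<lambda>v. g v * P v)" for s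
  have quad: "\<bar>H v - H u\<bar> \<le> 2 * C * (v - u)\<^sup>2" if uv: "0 \<le> u" "u \<le> v" "v \<le> q" for u v
  proof -
    have a: "integral {0..v} (\<lambda>u. \<kappa> u * D u) = integral {0..u} (\<lambda>u. \<kappa> u * D u) + integral {u..v} (\<lambda>u. \<kappa> u * D u)"
      using uv i1 by (intro Henstock_Kurzweil_Integration.integral_combine[symmetric]) auto
    have b: "integral {0..v} (\<lambda>v. g v * P v) = integral {0..u} (\<lambda>v. g v * P v) + integral {u..v} (\<lambda>v. g v * P v)"
      using uv i2 by (intro Henstock_Kurzweil_Integration.integral_combine[symmetric]) auto
    have c: "integral {u..v} (\<lambda>w. \<kappa> w * (D w - D v)) = integral {u..v} (\<lambda>w. \<kappa> w * D w) - integral {u..v} \<kappa> * D v"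
      using i1[of u v] \<kappa>i[of u v] uv
      by (simp add: right_diff_distrib integral_diff integrable_on_mult_left)
    have d: "integral {u..v} (\<lambda>w. g w * (P w - P u)) = integral {u..v} (\<lambda>w. g w * P w) - integral {u..v} g * P u"
      using i2[of u v] gi[of u v] uv
      by (simp add: right_diff_distrib integral_diff integrable_on_mult_left)
    have eq: "H v - H u = integral {u..v} (\<lambda>w. \<kappa> w * (D w - D v)) - integral {u..v} (\<lambda>w. g w * (P w - P u))"
      unfolding H_def a b c d Psplit[OF uv] Dsplit[OF uv] by (simp add: algebra_simps)
    have "\<bar>integral {u..v} (\<lambda>w. \<kappa> w * (D w - D v))\<bar> \<le> C * (v - u) * (v - u)"
    proof (rule bnd[OF uv(2)])
      show "(\<lambda>w. \<kappa> w * (D w - D v)) integrable_on {u..v}"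
        by (rule integrable_continuous_real, rule continuous_on_subset[of "{0..q}"])
          (use uv in \<open>auto intro!: continuous_intros \<kappa> Dc\<close>)
      fix w assume w: "w \<in> {u..v}"
      have "\<bar>D w - D v\<bar> \<le> 1 * (v - w)"
        using Dsplit[of w v] bnd[of w v g 1] gi[of w v] g1 w uv by auto
      then have "\<bar>D w - D v\<bar> \<le> v - u" using w by simp
      then show "\<bar>\<kappa> w * (D w - D v)\<bar> \<le> C * (v - u)"
        unfolding abs_mult using C[of w] w uv C0 by (intro mult_mono) auto
    qed
    moreover have "\<bar>integral {u..v} (\<lambda>w. g w * (P w - P u))\<bar> \<le> C * (v - u) * (v - u)"
    proof (rule bnd[OF uv(2)])
      show "(\<lambda>w. g w * (P w - P u)) integrable_on {u..v}"
        by (rule mono_on_mult_integrable) (use uv sub in \<open>auto intro!: continuous_intros continuous_on_subset[OF Pc]\<close>)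
      fix w assume w: "w \<in> {u..v}"
      have "\<bar>P w - P u\<bar> \<le> C * (w - u)"
        using Psplit[of u w] bnd[of u w \<kappa> C] \<kappa>i[of u w] C w uv by auto
      also have "\<dots> \<le> C * (v - u)" using w C0 by (intro mult_left_mono) auto
      finally have "\<bar>P w - P u\<bar> \<le> C * (v - u)" .
      then have "\<bar>g w\<bar> * \<bar>P w - P u\<bar> \<le> 1 * (C * (v - u))"
        using g1[of w] w uv by (intro mult_mono) auto
      then show "\<bar>g w * (P w - P u)\<bar> \<le> C * (v - u)" by (simp add: abs_mult)
    qed
    ultimately show ?thesis unfolding eq by (simp add: power2_eq_square)
  qed
  have "(H has_real_derivative 0) (at u within {0..q})" if u: "u \<in> {0..q}" for u
  proof -
    have "((\<lambda>v. (H v - H u) / (v - u)) \<longlongrightarrow> 0) (at u within {0..q})"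
    proof (rule tendsto_rabs_zero_cancel, rule tendsto_sandwich[of "\<lambda>_. 0"])
      show "\<forall>\<^sub>F v in at u within {0..q}. \<bar>(H v - H u) / (v - u)\<bar> \<le> 2 * C * \<bar>v - u\<bar>"
        unfolding eventually_at_filter
      proof (intro always_eventually allI impI)
        fix v assume v: "v \<noteq> u" "v \<in> {0..q}"
        have "\<bar>H v - H u\<bar> \<le> 2 * C * (v - u)\<^sup>2"
          using quad[of u v] quad[of v u] u v by (cases "u \<le> v") (auto simp: abs_minus_commute power2_commute)
        also have "\<dots> = 2 * C * \<bar>v - u\<bar> * \<bar>v - u\<bar>" by (simp add: power2_eq_square abs_mult_self_eq)
        finally show "\<bar>(H v - H u) / (v - u)\<bar> \<le> 2 * C * \<bar>v - u\<bar>"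
          using v(1) by (simp add: abs_divide pos_divide_le_eq)
      qed
      show "((\<lambda>v. 2 * C * \<bar>v - u\<bar>) \<longlongrightarrow> 0) (at u within {0..q})"
        by (auto intro!: tendsto_eq_intros)
    qed auto
    then show ?thesis by (simp add: has_field_derivative_iff)
  qed
  then obtain c where c: "\<And>s. s \<in> {0..q} \<Longrightarrow> H s = c"
    using has_field_derivative_zero_constant[of "{0..q}" H] by auto
  have "H 0 = 0" unfolding H_def P_def by simp
  moreover have "H 0 = H q" using c[of 0] c[of q] q by simp
  moreover have "D q = 0" unfolding D_def by simp
  ultimately show ?thesis unfolding H_def D_def P_def by simp
qed

section \<open>Distribution functions and their tail integrals\<close>

text \<open>The cutoff \<open>q\<close> is part of the predicate, so that one \<open>q\<close> can
  serve a whole sequence. The upper bound 1 follows from monotonicity; right continuity is asked for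
  separately in \<open>tail_inj\<close>.\<close>

definition is_cdf :: "real \<Rightarrow> (real \<Rightarrow> real) \<Rightarrow> bool" where
  "is_cdf q G \<longleftrightarrow> 0 < q \<and> q < 1 \<and> mono_on {0..1} G \<and> (\<forall>u\<in>{0..1}. 0 \<le> G u) \<and> (\<forall>u\<in>{q..1}. G u = 1)"

definition tail :: "(real \<Rightarrow> real) \<Rightarrow> real \<Rightarrow> real" where
  "tail G s = integral {s..1} G"

lemma is_cdfD:
  assumes "is_cdf q G"
  shows "0 < q" "q < 1" "mono_on {0..1} G"
    and "u \<in> {0..1} \<Longrightarrow> 0 \<le> G u" "u \<in> {0..1} \<Longrightarrow> G u \<le> 1" "u \<in> {q..1} \<Longrightarrow> G u = 1"
proof -
  show "u \<in> {0..1} \<Longrightarrow> G u \<le> 1"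
    using assms mono_onD[of "{0..1}" G u 1] unfolding is_cdf_def by auto
qed (use assms in \<open>auto simp: is_cdf_def\<close>)

lemma is_cdf_mult_integrable:
  assumes "is_cdf q G" "0 \<le> a" "b \<le> 1" "continuous_on {a..b} \<phi>"
  shows "(\<lambda>u. G u * \<phi> u) integrable_on {a..b}"
  using assms is_cdfD(3)[OF assms(1)]
  by (intro mono_on_mult_integrable) (auto intro: mono_on_subset)

lemma is_cdf_integrable:
  assumes "is_cdf q G" "0 \<le> a" "b \<le> 1"
  shows "G integrable_on {a..b}"
  using is_cdf_mult_integrable[OF assms continuous_on_const[of _ 1]] by simp

lemma tail_split:
  assumes "is_cdf q G" "0 \<le> s" "s \<le> u" "u \<le> 1"
  shows "tail G s = integral {s..u} G + tail G u"
  unfolding tail_def using assms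
  by (intro Henstock_Kurzweil_Integration.integral_combine[symmetric] is_cdf_integrable) auto

lemma tail_eq:
  assumes "is_cdf q G" "q \<le> s" "s \<le> 1"
  shows "tail G s = 1 - s"
proof -
  have "tail G s = integral {s..1} (\<lambda>_. 1)"
    unfolding tail_def using assms is_cdfD(6)[OF assms(1)] by (intro integral_cong) auto
  then show ?thesis using assms by simp
qed

lemma tail_le:
  assumes "is_cdf q G" "0 \<le> s" "s \<le> 1"
  shows "tail G s \<le> 1 - s"
proof -
  have "tail G s \<le> integral {s..1} (\<lambda>_. 1)"
    unfolding tail_def using assms is_cdfD(5)[OF assms(1)]
    by (intro integral_le is_cdf_integrable[OF assms(1)]) auto
  then show ?thesis using assms by simp
qed

lemma tail_ge:
  assumes "is_cdf q G" "0 \<le> s" "s \<le> q"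
  shows "tail G s \<ge> 1 - q"
proof -
  have "integral {s..q} G \<ge> 0"
    using assms is_cdfD[OF assms(1)] by (intro Henstock_Kurzweil_Integration.integral_nonneg is_cdf_integrable) auto
  then show ?thesis
    using tail_split[OF assms] tail_eq[OF assms(1), of q] is_cdfD(1,2)[OF assms(1)] by auto
qed

lemma tail_pos:
  assumes "is_cdf q G" "0 \<le> s" "s < 1"
  shows "tail G s > 0"
  using tail_ge[OF assms(1,2)] tail_eq[OF assms(1), of s] is_cdfD(1,2)[OF assms(1)] assms(3)
  by (cases "s \<le> q") auto

lemma continuous_on_tail:
  assumes "is_cdf q G"
  shows "continuous_on {0..1} (tail G)"
  unfolding tail_def using assms by (intro indefinite_integral_continuous_1' is_cdf_integrable) auto

text \<open>Equal tails give equal integrals over all intervals inside [0, q]. If the functions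
  differed at \<open>u\<close>, right continuity would keep their difference of one sign and at
  least half its size on some interval to the right of \<open>u\<close>.\<close>

lemma tail_inj:
  assumes G: "is_cdf q G" and H: "is_cdf q H"
    and rc: "\<And>u. u \<in> {0..<1} \<Longrightarrow> continuous (at_right u) G" "\<And>u. u \<in> {0..<1} \<Longrightarrow> continuous (at_right u) H"
    and eq: "\<And>s. s \<in> {0..q} \<Longrightarrow> tail G s = tail H s" and u: "u \<in> {0..1}"
  shows "G u = H u"
proof (cases "u \<ge> q")
  case True then show ?thesis using is_cdfD(6)[OF G] is_cdfD(6)[OF H] u by simp
next
  case False
  define m where "m w = G w - H w" for w
  have cm: "(m \<longlongrightarrow> m u) (at_right u)"
    using rc[of u] False u is_cdfD(2)[OF G] unfolding m_def continuous_within by (intro tendsto_diff) auto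
  show ?thesis
  proof (rule ccontr)
    assume ne: "G u \<noteq> H u"
    then have "\<bar>m u\<bar> / 2 > 0" by (simp add: m_def)
    from tendstoD[OF cm this] obtain b where b: "b > u" "\<And>w. u < w \<Longrightarrow> w < b \<Longrightarrow> dist (m w) (m u) < \<bar>m u\<bar> / 2"
      unfolding eventually_at_right_field by blast
    \<comment> \<open>\<open>v\<close> must stay below \<open>b\<close>, where the difference is
      under control, and not exceed \<open>q\<close>, up to which the tails are known to
      agree.\<close>
    define v where "v = min ((u + b) / 2) q"
    have v: "u < v" "v < b" "v \<le> q" using b(1) False by (auto simp: v_def min_less_iff_disj)
    have q1: "q < 1" using is_cdfD(2)[OF G] .
    have "integral {u..v} G = integral {u..v} H"
      using tail_split[OF G, of u v] tail_split[OF H, of u v] eq[of u] eq[of v] u v q1 by simp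
    then have "integral {u..v} (\<lambda>w. m w * sgn (m u)) = 0"
      unfolding m_def using v u q1 is_cdf_integrable[OF G, of u v] is_cdf_integrable[OF H, of u v]
      by (simp add: integral_diff)
    moreover have "integral {u..v} (\<lambda>w. \<bar>m u\<bar> / 2) \<le> integral {u..v} (\<lambda>w. m w * sgn (m u))"
    proof (rule integral_le)
      show "(\<lambda>w. m w * sgn (m u)) integrable_on {u..v}"
        unfolding m_def using v u q1 is_cdf_integrable[OF G, of u v] is_cdf_integrable[OF H, of u v]
        by (intro integrable_on_mult_left integrable_diff) auto
      fix w assume "w \<in> {u..v}"
      then have "\<bar>m w - m u\<bar> \<le> \<bar>m u\<bar> / 2"
        using b(2)[of w] v by (cases "w = u") (auto simp: dist_real_def)
      then show "\<bar>m u\<bar> / 2 \<le> m w * sgn (m u)" by (auto simp: sgn_if abs_if split: if_splits)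
    qed auto
    ultimately have "(v - u) * (\<bar>m u\<bar> / 2) \<le> 0" using v by auto
    then show False using v ne by (simp add: m_def mult_le_0_iff)
  qed
qed

text \<open>Weak convergence gives pointwise convergence of distribution functions only off the
  countably many jumps of the limit. Setting everything to 0 on that null set reduces the claim to
  convergence at every point.\<close>

lemma dominated_convergence_negligible:
  fixes f :: "nat \<Rightarrow> real \<Rightarrow> real"
  assumes f: "\<And>n. f n integrable_on {a..b}" and S: "negligible S"
    and le: "\<And>n x. x \<in> {a..b} \<Longrightarrow> \<bar>f n x\<bar> \<le> C"
    and lim: "\<And>x. x \<in> {a..b} - S \<Longrightarrow> (\<lambda>n. f n x) \<longlonglongrightarrow> g x"
  shows "(\<lambda>n. integral {a..b} (f n)) \<longlonglongrightarrow> integral {a..b} g"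
proof -
  define f' g' where "f' n x = (if x \<in> S then 0 else f n x)" and "g' x = (if x \<in> S then 0 else g x)" for n x
  have i: "f' n integrable_on {a..b}" for n
    by (rule integrable_spike[OF f S]) (simp add: f'_def)
  have "(\<lambda>n. integral {a..b} (f' n)) \<longlonglongrightarrow> integral {a..b} g'"
  proof (rule dominated_convergence(2)[OF i])
    show "(\<lambda>_. \<bar>C\<bar>) integrable_on {a..b}" by (rule integrable_const_ivl)
    show "norm (f' n x) \<le> \<bar>C\<bar>" if "x \<in> {a..b}" for n x
      using le[OF that, of n] by (cases "x \<in> S") (auto simp: f'_def)
    show "(\<lambda>n. f' n x) \<longlonglongrightarrow> g' x" if "x \<in> {a..b}" for x
      using lim[of x] that by (simp add: f'_def g'_def)
  qed
  moreover have "integral {a..b} (f' n) = integral {a..b} (f n)" for n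
    by (rule integral_spike[OF S]) (simp add: f'_def)
  moreover have "integral {a..b} g' = integral {a..b} g"
    by (rule integral_spike[OF S]) (simp add: g'_def)
  ultimately show ?thesis by simp
qed

section \<open>The functional on distribution functions\<close>

locale parisi_functional = resolvent_inverse +
  fixes \<beta> h :: real and \<xi>' :: "real \<Rightarrow> real"
  assumes beta_pos: "\<beta> > 0"
    and continuous_xi': "continuous_on {0..1} \<xi>'"
begin

definition B :: "real \<Rightarrow> (real \<Rightarrow> real) \<Rightarrow> real" where
  "B q G = 1 / 2 *
     (ln (2 * pi / \<beta>) + \<beta> * h\<^sup>2 / k (\<beta> * tail G 0)
      + (\<beta> * (1 - q) * k (\<beta> * (1 - q)) - (\<Sum>l\<leftarrow>ls. ln (k (\<beta> * (1 - q)) + l)) / N)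
      + integral {0..q} (\<lambda>u. \<beta> * k (\<beta> * tail G u))
      + \<beta>\<^sup>2 * integral {0..1} (\<lambda>u. G u * \<xi>' u))"

definition F :: "(real \<Rightarrow> real) \<Rightarrow> real \<Rightarrow> real" where
  "F G s = - h\<^sup>2 / (k (\<beta> * tail G 0))\<^sup>2 * k' (\<beta> * tail G 0) + \<xi>' s
     + integral {0..s} (\<lambda>u. k' (\<beta> * tail G u))"

lemma scaled_tail_pos: "is_cdf q G \<Longrightarrow> 0 \<le> u \<Longrightarrow> u < 1 \<Longrightarrow> \<beta> * tail G u > 0"
  using tail_pos beta_pos by simp

lemma continuous_on_comp_tail:
  assumes G: "is_cdf q G" and c: "continuous_on {0<..} \<phi>" and s: "s < 1"
  shows "continuous_on {0..s} (\<lambda>u. \<phi> (\<beta> * tail G u))"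
proof (rule continuous_on_compose2[OF c])
  show "continuous_on {0..s} (\<lambda>u. \<beta> * tail G u)"
    using s by (intro continuous_intros continuous_on_subset[OF continuous_on_tail[OF G]]) auto
  show "(\<lambda>u. \<beta> * tail G u) ` {0..s} \<subseteq> {0<..}" using scaled_tail_pos[OF G] s by auto
qed

lemma continuous_on_F:
  assumes G: "is_cdf q G" and s: "s < 1"
  shows "continuous_on {0..s} (F G)"
  unfolding F_def using s
  by (intro continuous_intros continuous_on_subset[OF continuous_xi'] indefinite_integral_continuous_1
      integrable_continuous_real continuous_on_comp_tail[OF G continuous_on_k']) auto

text \<open>Beyond \<open>q\<close> the tail is \<open>1 - u\<close>, so the added piece of the
  integral is explicit. By \<open>DERIV_legendre\<close> it is exactly the change of the terms that
  involve the cutoff.\<close>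

lemma B_indep:
  assumes G: "is_cdf q G" and q': "q \<le> q'" "q' < 1"
  shows "B q' G = B q G"
proof -
  have q: "0 < q" "q < 1" using is_cdfD[OF G] by auto
  define \<Phi> where "\<Phi> x = x * k x - (\<Sum>l\<leftarrow>ls. ln (k x + l)) / N" for x
  have i: "(\<lambda>u. \<beta> * k (\<beta> * tail G u)) integrable_on {0..q'}"
    using q' by (intro integrable_continuous_real continuous_intros continuous_on_comp_tail[OF G continuous_on_k])
  have "integral {q..q'} (\<lambda>u. \<beta> * k (\<beta> * tail G u)) = integral {q..q'} (\<lambda>u. \<beta> * k (\<beta> * (1 - u)))"
    using tail_eq[OF G] q' q by (intro integral_cong) auto
  also have "\<dots> = - \<Phi> (\<beta> * (1 - q')) - - \<Phi> (\<beta> * (1 - q))"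
  proof (rule integral_unique, rule fundamental_theorem_of_calculus[OF q'(1)])
    fix u assume u: "u \<in> {q..q'}"
    then have p: "\<beta> * (1 - u) > 0" using q' beta_pos by simp
    have "((\<lambda>u. - \<Phi> (\<beta> * (1 - u))) has_real_derivative - (k (\<beta> * (1 - u)) * (\<beta> * (0 - 1)))) (at u)"
      unfolding \<Phi>_def
      by (intro DERIV_minus DERIV_chain2[where g = "\<lambda>u. \<beta> * (1 - u)", OF DERIV_legendre[OF p]] DERIV_cmult DERIV_diff DERIV_const DERIV_ident)
    then show "((\<lambda>u. - \<Phi> (\<beta> * (1 - u))) has_vector_derivative \<beta> * k (\<beta> * (1 - u))) (at u within {q..q'})"
      by (simp add: has_real_derivative_iff_has_vector_derivative[symmetric] has_field_derivative_at_within mult.commute)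
  qed
  finally have "integral {0..q'} (\<lambda>u. \<beta> * k (\<beta> * tail G u)) =
      integral {0..q} (\<lambda>u. \<beta> * k (\<beta> * tail G u)) + (\<Phi> (\<beta> * (1 - q)) - \<Phi> (\<beta> * (1 - q')))"
    using Henstock_Kurzweil_Integration.integral_combine[OF _ q'(1) i] q by simp
  then show ?thesis unfolding B_def \<Phi>_def by simp
qed

lemma tail_diff:
  assumes G: "is_cdf q G" and H: "is_cdf q H" and u: "0 \<le> u" "u \<le> q"
  shows "tail H u - tail G u = integral {u..q} H - integral {u..q} G"
  using tail_split[OF G u] tail_split[OF H u] tail_eq[OF G, of q] tail_eq[OF H, of q] is_cdfD(2)[OF G]
  by simp

lemma F_mult_integrable:
  assumes "is_cdf q G" "is_cdf q' H" "s < 1"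
  shows "(\<lambda>v. H v * F G v) integrable_on {0..s}"
  using assms(3) by (intro is_cdf_mult_integrable[OF assms(2)] continuous_on_F[OF assms(1)]) auto

text \<open>Up to the factor \<open>\<beta>\<^sup>2 / 2\<close> the right side is the derivative of
  \<open>B\<close> at \<open>G\<close> in the direction \<open>H - G\<close>, so \<open>F\<close> is
  its density with respect to the distribution function. Exchanging the order of integration moves
  the tail off the integrand, and \<open>H - G\<close> vanishes beyond \<open>q\<close>.\<close>

lemma integral_F_diff:
  assumes G: "is_cdf q G" and H: "is_cdf q H"
  shows "integral {0..q} (\<lambda>v. F G v * (H v - G v)) =
     - h\<^sup>2 / (k (\<beta> * tail G 0))\<^sup>2 * k' (\<beta> * tail G 0) * (tail H 0 - tail G 0)
     + integral {0..1} (\<lambda>u. H u * \<xi>' u) - integral {0..1} (\<lambda>u. G u * \<xi>' u)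
     + integral {0..q} (\<lambda>u. k' (\<beta> * tail G u) * (tail H u - tail G u))"
proof -
  note q = is_cdfD(1,2)[OF G]
  define c where "c = - h\<^sup>2 / (k (\<beta> * tail G 0))\<^sup>2 * k' (\<beta> * tail G 0)"
  define \<kappa> where "\<kappa> u = k' (\<beta> * tail G u)" for u
  have \<kappa>: "continuous_on {0..q} \<kappa>" unfolding \<kappa>_def
    using q by (intro continuous_on_comp_tail[OF G continuous_on_k'])
  have P: "continuous_on {0..q} (\<lambda>v. integral {0..v} \<kappa>)"
    by (intro indefinite_integral_continuous_1 integrable_continuous_real \<kappa>)
  have x: "continuous_on {0..q} \<xi>'" using continuous_on_subset[OF continuous_xi', of "{0..q}"] q by auto
  have i: "X integrable_on {0..q}" "(\<lambda>v. X v * \<xi>' v) integrable_on {0..q}"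
    "(\<lambda>v. X v * integral {0..v} \<kappa>) integrable_on {0..q}"
    "(\<lambda>u. \<kappa> u * integral {u..q} X) integrable_on {0..q}"
    "(\<lambda>v. X v * \<xi>' v) integrable_on {0..1}"
    "integral {0..q} (\<lambda>u. \<kappa> u * integral {u..q} X) = integral {0..q} (\<lambda>v. X v * integral {0..v} \<kappa>)"
    if X: "is_cdf q X" for X
  proof -
    show "X integrable_on {0..q}" using q by (intro is_cdf_integrable[OF X]) auto
    from indefinite_integral_continuous_1'[OF this]
    show "(\<lambda>u. \<kappa> u * integral {u..q} X) integrable_on {0..q}"
      by (intro integrable_continuous_real continuous_on_mult \<kappa>)
    show "(\<lambda>v. X v * \<xi>' v) integrable_on {0..q}" "(\<lambda>v. X v * integral {0..v} \<kappa>) integrable_on {0..q}"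
      "(\<lambda>v. X v * \<xi>' v) integrable_on {0..1}"
      using q x P continuous_xi' by (intro is_cdf_mult_integrable[OF X]; auto)+
    show "integral {0..q} (\<lambda>u. \<kappa> u * integral {u..q} X) = integral {0..q} (\<lambda>v. X v * integral {0..v} \<kappa>)"
      using q is_cdfD[OF X] mono_on_subset[OF is_cdfD(3)[OF X], of "{0..q}"]
      by (intro integral_mult_tail_mono \<kappa>) auto
  qed
  note iG = i[OF G] and iH = i[OF H]
  have "integral {0..q} (\<lambda>v. F G v * (H v - G v)) =
      integral {0..q} (\<lambda>v. c * H v - c * G v + (H v * \<xi>' v - G v * \<xi>' v)
        + (H v * integral {0..v} \<kappa> - G v * integral {0..v} \<kappa>))"
  proof (intro integral_cong)
    fix v
    have "F G v = c + \<xi>' v + integral {0..v} \<kappa>" unfolding F_def c_def \<kappa>_def by simp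
    then show "F G v * (H v - G v) = c * H v - c * G v + (H v * \<xi>' v - G v * \<xi>' v)
        + (H v * integral {0..v} \<kappa> - G v * integral {0..v} \<kappa>)" by (simp add: algebra_simps)
  qed
  also have "\<dots> = (c * integral {0..q} H - c * integral {0..q} G)
      + (integral {0..q} (\<lambda>v. H v * \<xi>' v) - integral {0..q} (\<lambda>v. G v * \<xi>' v))
      + (integral {0..q} (\<lambda>v. H v * integral {0..v} \<kappa>) - integral {0..q} (\<lambda>v. G v * integral {0..v} \<kappa>))"
    by (intro integral_unique has_integral_add has_integral_diff has_integral_mult_right integrable_integral iG iH)
  also have "c * integral {0..q} H - c * integral {0..q} G = c * (tail H 0 - tail G 0)"
    using tail_diff[OF G H, of 0] q by (simp add: right_diff_distrib)
  also have "integral {0..q} (\<lambda>v. H v * \<xi>' v) - integral {0..q} (\<lambda>v. G v * \<xi>' v) =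
      integral {0..1} (\<lambda>u. H u * \<xi>' u) - integral {0..1} (\<lambda>u. G u * \<xi>' u)"
  proof -
    have "integral {q..1} (\<lambda>v. H v * \<xi>' v) = integral {q..1} (\<lambda>v. G v * \<xi>' v)"
      using is_cdfD(6)[OF G] is_cdfD(6)[OF H] by (intro integral_cong) auto
    then show ?thesis
      using Henstock_Kurzweil_Integration.integral_combine[OF _ _ iG(5), of q]
        Henstock_Kurzweil_Integration.integral_combine[OF _ _ iH(5), of q] q by simp
  qed
  also have "integral {0..q} (\<lambda>v. H v * integral {0..v} \<kappa>) - integral {0..q} (\<lambda>v. G v * integral {0..v} \<kappa>) =
      integral {0..q} (\<lambda>u. \<kappa> u * (tail H u - tail G u))"
  proof -
    have "integral {0..q} (\<lambda>u. \<kappa> u * (tail H u - tail G u)) =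
        integral {0..q} (\<lambda>u. \<kappa> u * integral {u..q} H - \<kappa> u * integral {u..q} G)"
      using tail_diff[OF G H] by (intro integral_cong) (simp add: right_diff_distrib)
    then show ?thesis using iG iH by (simp add: integral_diff)
  qed
  finally show ?thesis unfolding c_def \<kappa>_def by simp
qed

text \<open>The difference of the two sides equals \<open>\<beta> * h\<^sup>2 / 2\<close> times the
  tangent gap of \<open>1 / k\<close> at 0 plus \<open>\<beta> / 2\<close> times the integrated
  tangent gap of \<open>k\<close>; the \<open>\<xi>'\<close> term is linear and leaves no remainder.
  Strictness comes from the second gap: it is continuous, nonnegative, and positive wherever the
  tails differ.\<close>

lemma B_tangent:
  assumes G: "is_cdf q G" and H: "is_cdf q H"
  shows "B q H \<ge> B q G + \<beta>\<^sup>2 / 2 * integral {0..q} (\<lambda>v. F G v * (H v - G v))" (is ?le)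
    and "\<exists>s\<in>{0..q}. tail G s \<noteq> tail H s \<Longrightarrow>
      B q H > B q G + \<beta>\<^sup>2 / 2 * integral {0..q} (\<lambda>v. F G v * (H v - G v))" (is "_ \<Longrightarrow> ?less")
proof -
  note q = is_cdfD(1,2)[OF G]
  have c: "continuous_on {0..q} (\<lambda>u. k (\<beta> * tail X u))" "continuous_on {0..q} (\<lambda>u. k' (\<beta> * tail X u))"
    "continuous_on {0..q} (tail X)" if "is_cdf q X" for X
    using q that by (auto intro!: continuous_on_comp_tail continuous_on_k continuous_on_k'
        intro: continuous_on_subset[OF continuous_on_tail])
  note cG = c[OF G] and cH = c[OF H]
  define gap where "gap u = k (\<beta> * tail H u) - k (\<beta> * tail G u) - k' (\<beta> * tail G u) * (\<beta> * (tail H u - tail G u))" for u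
  have gc: "continuous_on {0..q} gap" unfolding gap_def by (intro continuous_intros cG cH)
  have gap0: "gap u \<ge> 0" if "u \<in> {0..q}" for u
    using k_tangent_le[OF scaled_tail_pos[OF G] scaled_tail_pos[OF H], of u u] that q
    unfolding gap_def by (simp add: right_diff_distrib)
  have I: "integral {0..q} gap = integral {0..q} (\<lambda>u. k (\<beta> * tail H u)) - integral {0..q} (\<lambda>u. k (\<beta> * tail G u))
      - \<beta> * integral {0..q} (\<lambda>u. k' (\<beta> * tail G u) * (tail H u - tail G u))"
  proof -
    have "integral {0..q} gap = integral {0..q} (\<lambda>u. k (\<beta> * tail H u) - k (\<beta> * tail G u)
        - \<beta> * (k' (\<beta> * tail G u) * (tail H u - tail G u)))"
      unfolding gap_def by (intro integral_cong) (simp add: algebra_simps)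
    also have "\<dots> = integral {0..q} (\<lambda>u. k (\<beta> * tail H u) - k (\<beta> * tail G u))
        - integral {0..q} (\<lambda>u. \<beta> * (k' (\<beta> * tail G u) * (tail H u - tail G u)))"
      by (intro integral_diff integrable_continuous_real continuous_intros cG cH)
    also have "integral {0..q} (\<lambda>u. k (\<beta> * tail H u) - k (\<beta> * tail G u)) =
        integral {0..q} (\<lambda>u. k (\<beta> * tail H u)) - integral {0..q} (\<lambda>u. k (\<beta> * tail G u))"
      by (intro integral_diff integrable_continuous_real cG cH)
    finally show ?thesis by simp
  qed
  define gap0 where "gap0 = 1 / k (\<beta> * tail H 0) - 1 / k (\<beta> * tail G 0)
      - - k' (\<beta> * tail G 0) / (k (\<beta> * tail G 0))\<^sup>2 * (\<beta> * (tail H 0 - tail G 0))"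
  have g0: "gap0 \<ge> 0"
    using inverse_k_tangent_le[OF scaled_tail_pos[OF G] scaled_tail_pos[OF H], of 0 0] q
    unfolding gap0_def by (simp add: right_diff_distrib)
  have id: "B q H - (B q G + \<beta>\<^sup>2 / 2 * integral {0..q} (\<lambda>v. F G v * (H v - G v))) =
      \<beta> * h\<^sup>2 / 2 * gap0 + \<beta> / 2 * integral {0..q} gap"
    unfolding I integral_F_diff[OF G H] B_def gap0_def
    by (simp add: power2_eq_square diff_divide_distrib algebra_simps)
  have nn: "integral {0..q} gap \<ge> 0"
    using gap0 by (intro Henstock_Kurzweil_Integration.integral_nonneg integrable_continuous_real gc) auto
  show ?le using id g0 nn beta_pos by (smt (verit) mult_nonneg_nonneg divide_nonneg_pos zero_le_power2)
  assume "\<exists>s\<in>{0..q}. tail G s \<noteq> tail H s"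
  then obtain s where s: "s \<in> {0..q}" "tail G s \<noteq> tail H s" by blast
  have "gap s > 0"
    using k_tangent_less[OF scaled_tail_pos[OF G] scaled_tail_pos[OF H], of s s] s q beta_pos
    unfolding gap_def by (simp add: right_diff_distrib)
  then have "integral {0..q} gap \<noteq> 0"
    using integral_eq_0_iff[OF gc q(1) gap0] s by force
  then have "\<beta> / 2 * integral {0..q} gap > 0" using nn beta_pos by simp
  moreover have "\<beta> * h\<^sup>2 / 2 * gap0 \<ge> 0" using g0 beta_pos by simp
  ultimately show ?less using id by linarith
qed

section \<open>Continuity under convergence of distribution functions\<close>

lemma tail_tendsto:
  assumes Gn: "\<And>n. is_cdf q (Gn n)" and S: "negligible S"
    and lim: "\<And>x. x \<in> {0..1} - S \<Longrightarrow> (\<lambda>n. Gn n x) \<longlonglongrightarrow> G x" and s: "s \<in> {0..1}"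
  shows "(\<lambda>n. tail (Gn n) s) \<longlonglongrightarrow> tail G s"
  unfolding tail_def
proof (rule dominated_convergence_negligible[OF _ S])
  show "Gn n integrable_on {s..1}" for n using s by (intro is_cdf_integrable[OF Gn]) auto
  show "\<bar>Gn n x\<bar> \<le> 1" if "x \<in> {s..1}" for n x using is_cdfD(4,5)[OF Gn, of x n] that s by auto
qed (use lim s in auto)

lemma tail_bounds:
  assumes "is_cdf q G" "u \<in> {0..q}"
  shows "\<beta> * (1 - q) \<le> \<beta> * tail G u" "\<beta> * tail G u \<le> \<beta>"
  using tail_ge[OF assms(1), of u] tail_le[OF assms(1), of u] is_cdfD(1,2)[OF assms(1)] assms(2) beta_pos
  by auto

text \<open>With a common cutoff all arguments stay in the compact interval from
  \<open>\<beta> * (1 - q)\<close> to \<open>\<beta>\<close>, away from the singularity at 0. A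
  continuous \<open>\<phi>\<close> is bounded there, which gives the dominating constant.\<close>

lemma comp_tail_tendsto:
  fixes \<phi> :: "real \<Rightarrow> real"
  assumes Gn: "\<And>n. is_cdf q (Gn n)" and G: "is_cdf q G" and S: "negligible S"
    and lim: "\<And>x. x \<in> {0..1} - S \<Longrightarrow> (\<lambda>n. Gn n x) \<longlonglongrightarrow> G x"
    and \<phi>: "continuous_on {0<..} \<phi>" and s: "s \<in> {0..q}"
  shows "(\<lambda>n. \<phi> (\<beta> * tail (Gn n) s)) \<longlonglongrightarrow> \<phi> (\<beta> * tail G s)"
    and "(\<lambda>n. integral {0..s} (\<lambda>u. \<phi> (\<beta> * tail (Gn n) u))) \<longlonglongrightarrow> integral {0..s} (\<lambda>u. \<phi> (\<beta> * tail G u))"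
proof -
  note q = is_cdfD(1,2)[OF G]
  have *: "(\<lambda>n. \<phi> (\<beta> * tail (Gn n) s)) \<longlonglongrightarrow> \<phi> (\<beta> * tail G s)" if s: "s \<in> {0..q}" for s
  proof (rule continuous_on_tendsto_compose[OF \<phi>])
    show "(\<lambda>n. \<beta> * tail (Gn n) s) \<longlonglongrightarrow> \<beta> * tail G s"
      using s q by (intro tendsto_intros tail_tendsto[OF Gn S lim]) auto
    show "\<beta> * tail G s \<in> {0<..}" using scaled_tail_pos[OF G] s q by simp
    show "\<forall>\<^sub>F n in sequentially. \<beta> * tail (Gn n) s \<in> {0<..}" using scaled_tail_pos[OF Gn] s q by simp
  qed
  show "(\<lambda>n. \<phi> (\<beta> * tail (Gn n) s)) \<longlonglongrightarrow> \<phi> (\<beta> * tail G s)" using *[OF s] .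
  have "continuous_on {\<beta> * (1 - q)..\<beta>} \<phi>"
  proof (rule continuous_on_subset[OF \<phi>], rule subsetI)
    fix x assume "x \<in> {\<beta> * (1 - q)..\<beta>}"
    moreover have "\<beta> * (1 - q) > 0" using q beta_pos by simp
    ultimately show "x \<in> {0<..}" by simp
  qed
  from compact_imp_bounded[OF compact_continuous_image[OF this compact_Icc]]
  obtain C where C: "\<And>x. x \<in> {\<beta> * (1 - q)..\<beta>} \<Longrightarrow> \<bar>\<phi> x\<bar> \<le> C"
    unfolding bounded_iff by (metis imageI real_norm_def)
  show "(\<lambda>n. integral {0..s} (\<lambda>u. \<phi> (\<beta> * tail (Gn n) u))) \<longlonglongrightarrow> integral {0..s} (\<lambda>u. \<phi> (\<beta> * tail G u))"
  proof (rule dominated_convergence_negligible[OF _ negligible_empty])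
    show "(\<lambda>u. \<phi> (\<beta> * tail (Gn n) u)) integrable_on {0..s}" for n
      using s q by (intro integrable_continuous_real continuous_on_comp_tail[OF Gn \<phi>]) auto
    show "\<bar>\<phi> (\<beta> * tail (Gn n) u)\<bar> \<le> C" if "u \<in> {0..s}" for n u
      using C tail_bounds[OF Gn, of u n] that s by auto
  qed (use * s in auto)
qed

lemma B_tendsto:
  assumes Gn: "\<And>n. is_cdf q (Gn n)" and G: "is_cdf q G" and S: "negligible S"
    and lim: "\<And>x. x \<in> {0..1} - S \<Longrightarrow> (\<lambda>n. Gn n x) \<longlonglongrightarrow> G x"
  shows "(\<lambda>n. B q (Gn n)) \<longlonglongrightarrow> B q G"
proof -
  note q = is_cdfD(1,2)[OF G]
  note conv = comp_tail_tendsto[OF Gn G S lim continuous_on_k]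
  obtain C where C: "\<And>x. x \<in> {0..1} \<Longrightarrow> \<bar>\<xi>' x\<bar> \<le> C"
    using compact_imp_bounded[OF compact_continuous_image[OF continuous_xi' compact_Icc]]
    unfolding bounded_iff by (metis imageI real_norm_def)
  have x: "(\<lambda>n. integral {0..1} (\<lambda>u. Gn n u * \<xi>' u)) \<longlonglongrightarrow> integral {0..1} (\<lambda>u. G u * \<xi>' u)"
  proof (rule dominated_convergence_negligible[OF _ S])
    show "(\<lambda>u. Gn n u * \<xi>' u) integrable_on {0..1}" for n
      by (intro is_cdf_mult_integrable[OF Gn] continuous_xi') auto
    show "\<bar>Gn n u * \<xi>' u\<bar> \<le> 1 * C" if "u \<in> {0..1}" for n u
      unfolding abs_mult using is_cdfD(4,5)[OF Gn that] C[OF that] by (intro mult_mono) auto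
    show "(\<lambda>n. Gn n u * \<xi>' u) \<longlonglongrightarrow> G u * \<xi>' u" if "u \<in> {0..1} - S" for u
      by (intro tendsto_intros lim that)
  qed
  have "k (\<beta> * tail G 0) \<noteq> 0" using pos[OF scaled_tail_pos[OF G, of 0]] q by simp
  then show ?thesis unfolding B_def integral_mult_right using q
    by (intro tendsto_intros x conv) auto
qed

lemma F_tendsto:
  assumes Gn: "\<And>n. is_cdf q (Gn n)" and G: "is_cdf q G" and S: "negligible S"
    and lim: "\<And>x. x \<in> {0..1} - S \<Longrightarrow> (\<lambda>n. Gn n x) \<longlonglongrightarrow> G x" and s: "s \<in> {0..q}"
  shows "(\<lambda>n. F (Gn n) s) \<longlonglongrightarrow> F G s"
proof -
  note q = is_cdfD(1,2)[OF G]
  have "k (\<beta> * tail G 0) \<noteq> 0" using pos[OF scaled_tail_pos[OF G, of 0]] q by simp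
  then show ?thesis unfolding F_def using q s
    by (intro tendsto_intros comp_tail_tendsto[OF Gn G S lim continuous_on_k]
        comp_tail_tendsto[OF Gn G S lim continuous_on_k']) auto
qed

text \<open>The term is \<open>h\<^sup>2\<close> times the slope of \<open>1 / k\<close> at a point
  of at most \<open>\<beta>\<close>, and these slopes increase. The bound does not involve
  \<open>q\<close> or \<open>G\<close>, which \<open>F_negative_near_1\<close> relies on.\<close>

lemma field_term_bounds:
  assumes G: "is_cdf q G"
  defines "c \<equiv> - h\<^sup>2 / (k (\<beta> * tail G 0))\<^sup>2 * k' (\<beta> * tail G 0)"
  shows "0 \<le> c" "c \<le> h\<^sup>2 * (- k' \<beta> / (k \<beta>)\<^sup>2)"
proof -
  note q = is_cdfD(1,2)[OF G]
  have b: "0 < \<beta> * tail G 0" "\<beta> * tail G 0 \<le> \<beta>"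
    using scaled_tail_pos[OF G, of 0] tail_bounds[OF G, of 0] q by auto
  have c: "c = h\<^sup>2 * (- k' (\<beta> * tail G 0) / (k (\<beta> * tail G 0))\<^sup>2)" unfolding c_def by simp
  show "0 \<le> c" unfolding c using k'_neg[OF b(1)]
    by (intro mult_nonneg_nonneg divide_nonneg_nonneg) auto
  show "c \<le> h\<^sup>2 * (- k' \<beta> / (k \<beta>)\<^sup>2)" unfolding c by (intro mult_left_mono inverse_k_deriv_mono b) auto
qed

lemma F_bounded:
  assumes q: "0 < q" "q < 1"
  obtains C where "\<And>G s. is_cdf q G \<Longrightarrow> s \<in> {0..q} \<Longrightarrow> \<bar>F G s\<bar> \<le> C"
proof -
  obtain C where C: "\<And>x. x \<in> {0..1} \<Longrightarrow> \<bar>\<xi>' x\<bar> \<le> C"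
    using compact_imp_bounded[OF compact_continuous_image[OF continuous_xi' compact_Icc]]
    unfolding bounded_iff by (metis imageI real_norm_def)
  define A where "A = h\<^sup>2 * (- k' \<beta> / (k \<beta>)\<^sup>2)"
  \<comment> \<open>\<open>k'\<close> is negative and increasing, so its size is greatest at the
    smallest argument that a tail can produce.\<close>
  define E where "E = - k' (\<beta> * (1 - q))"
  have p: "\<beta> * (1 - q) > 0" using q beta_pos by simp
  show thesis
  proof (rule that[of "A + C + E"])
    fix G s assume G: "is_cdf q G" and s: "s \<in> {0..q}"
    have "norm (integral {0..s} (\<lambda>u. k' (\<beta> * tail G u))) \<le> E * (s - 0)"
    proof (rule integral_bound)
      show "continuous_on {0..s} (\<lambda>u. k' (\<beta> * tail G u))"
        using s q by (intro continuous_on_comp_tail[OF G continuous_on_k']) auto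
      fix u assume u: "u \<in> {0..s}"
      have "k' (\<beta> * (1 - q)) \<le> k' (\<beta> * tail G u)"
        using tail_bounds[OF G, of u] u s by (intro k'_mono p) auto
      moreover have "k' (\<beta> * tail G u) < 0" using u s q by (intro k'_neg scaled_tail_pos[OF G]) auto
      ultimately show "norm (k' (\<beta> * tail G u)) \<le> E" by (simp add: E_def)
    qed (use s in auto)
    also have "\<dots> \<le> E * 1" using s q k'_neg[OF p] by (intro mult_left_mono) (auto simp: E_def)
    finally have "\<bar>integral {0..s} (\<lambda>u. k' (\<beta> * tail G u))\<bar> \<le> E" by simp
    moreover have "\<bar>\<xi>' s\<bar> \<le> C" using C s q by auto
    ultimately show "\<bar>F G s\<bar> \<le> A + C + E"
      using field_term_bounds[OF G] unfolding F_def A_def by linarith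
  qed
qed

text \<open>Every tail is at most \<open>1 - u\<close> and \<open>k'\<close> increases, so the
  integral in \<open>F\<close> is largest for the tail \<open>1 - u\<close>. There it equals
  \<open>(k \<beta> - k (\<beta> * (1 - s))) / \<beta>\<close>, which falls below any bound as
  \<open>s\<close> tends to 1. The resulting cutoff works for all distribution functions at
  once.\<close>

lemma F_negative_near_1:
  obtains q where "0 < q" "q < 1" "\<And>q' G s. is_cdf q' G \<Longrightarrow> s \<in> {q..<1} \<Longrightarrow> F G s < 0"
proof -
  obtain C where C: "\<And>x. x \<in> {0..1} \<Longrightarrow> \<bar>\<xi>' x\<bar> \<le> C"
    using compact_imp_bounded[OF compact_continuous_image[OF continuous_xi' compact_Icc]]
    unfolding bounded_iff by (metis imageI real_norm_def)
  define A where "A = h\<^sup>2 * (- k' \<beta> / (k \<beta>)\<^sup>2)"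
  \<comment> \<open>\<open>E\<close> is chosen so that
    \<open>k (\<beta> * (1 - s)) \<ge> E - sum_list ls\<close> beats \<open>A + C\<close>, and
    \<open>q\<close> so that \<open>1 / (\<beta> * (1 - s)) \<ge> E\<close> for
    \<open>s \<ge> q\<close>. The two maxima only keep \<open>E\<close> and \<open>q\<close>
    positive.\<close>
  define E where "E = max 1 (\<beta> * (A + C) + k \<beta> + sum_list ls + 1)"
  define q where "q = max (1/2) (1 - 1 / (\<beta> * E))"
  have E: "E \<ge> 1" by (simp add: E_def)
  have "\<beta> * E > 0" using E beta_pos by simp
  then have q: "0 < q" "q < 1" by (auto simp: q_def less_max_iff_disj)
  show thesis
  proof (rule that[OF q])
    fix q' G s assume G: "is_cdf q' G" and s: "s \<in> {q..<1}"
    then have s01: "0 \<le> s" "s < 1" using q by auto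
    have p: "\<beta> * (1 - u) > 0" if "u \<in> {0..s}" for u using that s beta_pos by simp
    have I: "((\<lambda>u. k' (\<beta> * (1 - u))) has_integral - k (\<beta> * (1 - s)) / \<beta> - - k (\<beta> * (1 - 0)) / \<beta>) {0..s}"
    proof (rule fundamental_theorem_of_calculus[OF s01(1)])
      fix u assume u: "u \<in> {0..s}"
      have "((\<lambda>u. - k (\<beta> * (1 - u)) / \<beta>) has_real_derivative - (k' (\<beta> * (1 - u)) * (\<beta> * (0 - 1))) / \<beta>) (at u)"
        by (intro DERIV_cdivide DERIV_minus DERIV_chain2[where f = k and g = "\<lambda>u. \<beta> * (1 - u)", OF DERIV_k[OF p[OF u]]] DERIV_cmult DERIV_diff DERIV_const DERIV_ident)
      then show "((\<lambda>u. - k (\<beta> * (1 - u)) / \<beta>) has_vector_derivative k' (\<beta> * (1 - u))) (at u within {0..s})"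
        using beta_pos
        by (simp add: has_real_derivative_iff_has_vector_derivative[symmetric] has_field_derivative_at_within)
    qed
    have "integral {0..s} (\<lambda>u. k' (\<beta> * tail G u)) \<le> integral {0..s} (\<lambda>u. k' (\<beta> * (1 - u)))"
    proof (rule integral_le)
      show "(\<lambda>u. k' (\<beta> * tail G u)) integrable_on {0..s}"
        using s01 by (intro integrable_continuous_real continuous_on_comp_tail[OF G continuous_on_k'])
      show "k' (\<beta> * tail G u) \<le> k' (\<beta> * (1 - u))" if u: "u \<in> {0..s}" for u
        using tail_le[OF G, of u] u s01 beta_pos by (intro k'_mono scaled_tail_pos[OF G]) auto
    qed (use I in blast)
    also have "\<dots> = (k \<beta> - k (\<beta> * (1 - s))) / \<beta>" using integral_unique[OF I] by (simp add: diff_divide_distrib)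
    finally have 1: "integral {0..s} (\<lambda>u. k' (\<beta> * tail G u)) \<le> (k \<beta> - k (\<beta> * (1 - s))) / \<beta>" .
    have "1 - s \<le> 1 / (\<beta> * E)" using s by (auto simp: q_def)
    then have "\<beta> * (1 - s) * E \<le> 1" using beta_pos E by (simp add: field_simps)
    then have "E \<le> 1 / (\<beta> * (1 - s))" using p[of s] s01 by (simp add: pos_le_divide_eq mult.commute)
    then have "k (\<beta> * (1 - s)) \<ge> E - sum_list ls" using k_lower_bound[OF p[of s]] s01 by simp
    then have "k (\<beta> * (1 - s)) > \<beta> * (A + C) + k \<beta>" unfolding E_def by linarith
    then have "(k \<beta> - k (\<beta> * (1 - s))) / \<beta> < - (A + C)"
      using beta_pos by (subst pos_divide_less_eq) (auto simp: algebra_simps)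
    moreover have "\<bar>\<xi>' s\<bar> \<le> C" using C s01 by auto
    ultimately show "F G s < 0" using 1 field_term_bounds[OF G] unfolding F_def A_def by linarith
  qed
qed

end

section \<open>Measures on the unit interval\<close>

lemma YmeasD:
  assumes "\<zeta> \<in> Ymeas"
  shows "prob_space \<zeta>" "space \<zeta> = {0..1}" "sets \<zeta> = sets (restrict_space borel {0..1})"
  using assms by (auto simp: Ymeas_def)

lemma sets_Ymeas_iff: "\<zeta> \<in> Ymeas \<Longrightarrow> A \<in> sets \<zeta> \<longleftrightarrow> A \<in> sets borel \<and> A \<subseteq> {0..1}"
  using YmeasD(3)[of \<zeta>] by (auto simp: sets_restrict_space_iff)

lemma YmeasI:
  assumes "prob_space \<zeta>" "space \<zeta> = {0..1}" "sets \<zeta> = sets (restrict_space borel {0..1})"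
    and "q < 1" "measure \<zeta> {q<..1} = 0" "0 \<le> q"
  shows "\<zeta> \<in> Ymeas"
proof -
  interpret prob_space \<zeta> by fact
  have "emeasure \<zeta> ({q<..} \<inter> space \<zeta>) = 0"
  proof -
    have "{q<..} \<inter> {0..1} = {q<..1}" using assms by auto
    then show ?thesis using assms by (simp add: emeasure_eq_measure)
  qed
  then have "1 \<notin> msupport \<zeta>" using assms(4) unfolding msupport_def
    by (auto intro!: exI[of _ "{q<..}"])
  then show ?thesis using assms by (simp add: Ymeas_def)
qed

lemma Ymeas_gap:
  assumes "\<zeta> \<in> Ymeas"
  obtains q where "0 < q" "q < 1" "measure \<zeta> {q..1} = 0"
proof -
  interpret prob_space \<zeta> using YmeasD[OF assms] by simp
  have "1 \<in> space \<zeta>" using YmeasD[OF assms] by simp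
  then obtain U where U: "open U" "1 \<in> U" "emeasure \<zeta> (U \<inter> {0..1}) = 0"
    using assms YmeasD(2)[OF assms] unfolding Ymeas_def msupport_def by (auto simp: zero_less_iff_neq_zero)
  obtain e where e: "e > 0" "\<And>x. dist x 1 < e \<Longrightarrow> x \<in> U" using U open_dist by blast
  \<comment> \<open>Half the radius keeps the closed interval inside the null neighbourhood of 1,
    and 1/2 keeps \<open>q\<close> positive.\<close>
  define q where "q = max (1/2) (1 - e / 2)"
  have "{q..1} \<subseteq> U \<inter> {0..1}"
    using e by (auto simp: q_def dist_real_def intro!: e(2))
  moreover have "U \<inter> {0..1} \<in> sets \<zeta>" using U(1) by (simp add: sets_Ymeas_iff[OF assms])
  ultimately have "measure \<zeta> {q..1} \<le> measure \<zeta> (U \<inter> {0..1})" by (intro finite_measure_mono)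
  moreover have "measure \<zeta> (U \<inter> {0..1}) = 0" using U(3) by (simp add: measure_def)
  ultimately have "measure \<zeta> {q..1} = 0" using measure_nonneg[of \<zeta> "{q..1}"] by linarith
  moreover have "0 < q" "q < 1" using e by (auto simp: q_def)
  ultimately show thesis using that by blast
qed

text \<open>The null set is half open, unlike the one in \<open>B_fun\<close>: an atom at
  \<open>q\<close> is allowed, so the class of measures with a given \<open>q\<close> consists of
  those on the closed interval [0, q] and survives weak limits.\<close>

lemma Ymeas_is_cdf:
  assumes Y: "\<zeta> \<in> Ymeas" and q: "0 < q" "q < 1" "measure \<zeta> {q<..1} = 0"
  shows "is_cdf q (\<lambda>u. measure \<zeta> {0..u})"
proof -
  interpret prob_space \<zeta> using YmeasD[OF Y] by simp
  note S = sets_Ymeas_iff[OF Y]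
  have "measure \<zeta> {0..u} = 1" if u: "u \<in> {q..1}" for u
  proof -
    have "1 = measure \<zeta> {0..1}" using prob_space YmeasD(2)[OF Y] by simp
    also have "\<dots> \<le> measure \<zeta> ({0..u} \<union> {q<..1})" using u q by (intro finite_measure_mono) (auto simp: S)
    also have "\<dots> \<le> measure \<zeta> {0..u} + measure \<zeta> {q<..1}"
      using u q by (intro measure_subadditive) (auto simp: S)
    finally show ?thesis using q prob_le_1[of "{0..u}"] by simp
  qed
  moreover have "mono_on {0..1} (\<lambda>u. measure \<zeta> {0..u})"
    by (intro mono_onI finite_measure_mono) (auto simp: S)
  ultimately show ?thesis using q by (simp add: is_cdf_def)
qed

lemma Ymeas_gap_le:
  assumes Y: "\<zeta> \<in> Ymeas" and q: "0 \<le> q" "measure \<zeta> {q..1} = 0" "q \<le> q'"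
  shows "measure \<zeta> {q'<..1} = 0"
proof -
  interpret prob_space \<zeta> using YmeasD[OF Y] by simp
  have "measure \<zeta> {q'<..1} \<le> measure \<zeta> {q..1}"
    using q by (intro finite_measure_mono) (auto simp: sets_Ymeas_iff[OF Y])
  then show ?thesis using q by (auto simp: measure_le_0_iff)
qed

text \<open>The same measure viewed on the whole line, where distribution functions determine
  measures and tight sequences have convergent subsequences.\<close>

definition extend_borel :: "real measure \<Rightarrow> real measure" where
  "extend_borel \<zeta> = distr \<zeta> borel (\<lambda>x. x)"

lemma Ymeas_measurable_ident:
  assumes "\<zeta> \<in> Ymeas"
  shows "(\<lambda>x. x) \<in> borel_measurable \<zeta>"
proof -
  have "(\<lambda>x. x) \<in> borel_measurable (restrict_space borel {0..1::real})"
    by (rule measurable_restrict_space1) simp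
  then show ?thesis using measurable_cong_sets[OF YmeasD(3)[OF assms] refl] by blast
qed

lemma measure_extend_borel:
  assumes "\<zeta> \<in> Ymeas" "A \<in> sets borel"
  shows "measure (extend_borel \<zeta>) A = measure \<zeta> (A \<inter> {0..1})"
  unfolding extend_borel_def
  using measure_distr[OF Ymeas_measurable_ident[OF assms(1)] assms(2)] YmeasD(2)[OF assms(1)]
  by simp

lemma real_distribution_extend_borel:
  assumes "\<zeta> \<in> Ymeas"
  shows "real_distribution (extend_borel \<zeta>)"
  unfolding extend_borel_def
  using prob_space.real_distribution_distr[OF YmeasD(1)[OF assms] Ymeas_measurable_ident[OF assms]] .

lemma cdf_extend_borel:
  assumes Y: "\<zeta> \<in> Ymeas"
  shows "u < 0 \<Longrightarrow> cdf (extend_borel \<zeta>) u = 0"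
    "u \<in> {0..1} \<Longrightarrow> cdf (extend_borel \<zeta>) u = measure \<zeta> {0..u}"
    "u \<ge> 1 \<Longrightarrow> cdf (extend_borel \<zeta>) u = 1"
proof -
  interpret prob_space \<zeta> using YmeasD[OF Y] by simp
  have *: "cdf (extend_borel \<zeta>) u = measure \<zeta> ({..u} \<inter> {0..1})" for u
    unfolding cdf_def by (rule measure_extend_borel[OF Y]) simp
  show "cdf (extend_borel \<zeta>) u = 0" if "u < 0"
  proof -
    have "{..u} \<inter> {0..1} = {}" using that by auto
    then show ?thesis by (simp add: *)
  qed
  show "cdf (extend_borel \<zeta>) u = measure \<zeta> {0..u}" if "u \<in> {0..1}"
  proof -
    have "{..u} \<inter> {0..1} = {0..u}" using that by auto
    then show ?thesis unfolding * by (rule arg_cong)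
  qed
  show "cdf (extend_borel \<zeta>) u = 1" if "u \<ge> 1"
  proof -
    have "{..u} \<inter> {0..1} = space \<zeta>" using that YmeasD(2)[OF Y] by auto
    then show ?thesis by (simp add: * prob_space)
  qed
qed

lemma Ymeas_cdf_right_continuous:
  assumes Y: "\<zeta> \<in> Ymeas" and u: "u \<in> {0..<1}"
  shows "continuous (at_right u) (\<lambda>u. measure \<zeta> {0..u})"
proof -
  interpret real_distribution "extend_borel \<zeta>" by (rule real_distribution_extend_borel[OF Y])
  have "(cdf (extend_borel \<zeta>) \<longlongrightarrow> measure \<zeta> {0..u}) (at_right u)"
    using cdf_is_right_cont[of u] cdf_extend_borel(2)[OF Y, of u] u by (simp add: continuous_within)
  moreover have "\<forall>\<^sub>F v in at_right u. cdf (extend_borel \<zeta>) v = measure \<zeta> {0..v}"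
    using u cdf_extend_borel(2)[OF Y] unfolding eventually_at_right_field by (intro exI[of _ 1]) auto
  ultimately show ?thesis using tendsto_cong by (force simp: continuous_within)
qed

lemma Ymeas_eqI:
  assumes Y: "\<zeta> \<in> Ymeas" "\<eta> \<in> Ymeas"
    and eq: "\<And>u. u \<in> {0..1} \<Longrightarrow> measure \<zeta> {0..u} = measure \<eta> {0..u}"
  shows "\<zeta> = \<eta>"
proof (rule measure_eqI)
  interpret z: prob_space \<zeta> using YmeasD[OF Y(1)] by simp
  interpret e: prob_space \<eta> using YmeasD[OF Y(2)] by simp
  show "sets \<zeta> = sets \<eta>" using YmeasD(3)[OF Y(1)] YmeasD(3)[OF Y(2)] by simp
  have "cdf (extend_borel \<zeta>) u = cdf (extend_borel \<eta>) u" for u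
    using cdf_extend_borel[OF Y(1), of u] cdf_extend_borel[OF Y(2), of u] eq[of u]
    by (cases "u < 0"; cases "u \<le> 1") auto
  then have E: "extend_borel \<zeta> = extend_borel \<eta>"
    by (intro cdf_unique real_distribution_extend_borel Y) auto
  fix A assume "A \<in> sets \<zeta>"
  then have A: "A \<in> sets borel" "A \<inter> {0..1} = A" by (auto simp: sets_Ymeas_iff[OF Y(1)])
  then show "emeasure \<zeta> A = emeasure \<eta> A"
    using measure_extend_borel[OF Y(1) A(1)] measure_extend_borel[OF Y(2) A(1)] E
    by (simp add: z.emeasure_eq_measure e.emeasure_eq_measure)
qed

text \<open>The way back from \<open>extend_borel\<close>, used for the weak limit of a minimizing
  sequence.\<close>

lemma Ymeas_of_distribution:
  assumes M: "real_distribution M" and q: "0 \<le> q" "q < 1"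
    and cdf: "\<And>u. u < 0 \<Longrightarrow> cdf M u = 0" "cdf M q = 1"
  obtains \<zeta> where "\<zeta> \<in> Ymeas" "measure \<zeta> {q<..1} = 0" "\<And>u. u \<in> {0..1} \<Longrightarrow> measure \<zeta> {0..u} = cdf M u"
proof -
  interpret real_distribution M by fact
  have neg: "measure M {..<0} = 0"
  proof -
    \<comment> \<open>A distribution function measures closed half lines, so the open one is
      exhausted by countably many of them.\<close>
    have "{..<0 :: real} = (\<Union>n. {..- 1 / real (Suc n)})"
    proof (intro equalityI subsetI)
      fix x :: real assume "x \<in> {..<0}"
      then obtain n where "1 / real (Suc n) < - x"
        using reals_Archimedean[of "- x"] by (auto simp: inverse_eq_divide)
      then show "x \<in> (\<Union>n. {..- 1 / real (Suc n)})" by (auto intro!: exI[of _ n])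
    next
      fix x :: real assume "x \<in> (\<Union>n. {..- 1 / real (Suc n)})"
      then obtain n where "x \<le> - 1 / real (Suc n)" by auto
      moreover have "- 1 / real (Suc n) < 0" by simp
      ultimately show "x \<in> {..<0}" by (metis lessThan_iff le_less_trans)
    qed
    moreover have "(\<Union>n. {..- 1 / real (Suc n)}) \<in> null_sets M"
    proof (rule null_sets_UN)
      fix n
      have "measure M {..- 1 / real (Suc n)} = 0" using cdf(1)[of "- 1 / real (Suc n)"] by (simp add: cdf_def)
      then show "{..- 1 / real (Suc n)} \<in> null_sets M" by (simp add: null_sets_def emeasure_eq_measure)
    qed
    ultimately have "{..<0} \<in> null_sets M" by metis
    then show ?thesis by (simp add: null_sets_def measure_def)
  qed
  define \<zeta> where "\<zeta> = restrict_space M {0..1}"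
  have sp: "space \<zeta> = {0..1}" by (simp add: \<zeta>_def space_restrict_space)
  have st: "sets \<zeta> = sets (restrict_space borel {0..1})"
    unfolding \<zeta>_def by (rule sets_restrict_space_cong) simp
  have ms: "measure \<zeta> A = measure M A" if "A \<subseteq> {0..1}" for A
    unfolding \<zeta>_def using that by (intro measure_restrict_space) auto
  have Icc: "measure M {0..u} = cdf M u" if "u \<ge> 0" for u
  proof -
    have "{..u} = {..<0} \<union> {0..u}" using that by auto
    then have "cdf M u = measure M ({..<0} \<union> {0..u})" by (simp add: cdf_def)
    also have "\<dots> = measure M {..<0} + measure M {0..u}" by (rule finite_measure_Union) auto
    finally show ?thesis using neg by simp
  qed
  have c1: "cdf M u = 1" if "u \<ge> q" for u
    using cdf_nondecreasing[OF that] cdf(2) cdf_bounded_prob[of u] by simp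
  have "prob_space \<zeta>"
  proof (rule prob_spaceI)
    have "measure \<zeta> {0..1} = 1" using ms[of "{0..1}"] Icc[of 1] c1[of 1] q by simp
    then show "emeasure \<zeta> (space \<zeta>) = 1"
      unfolding sp using emeasure_restrict_space[of "{0..1}" M "{0..1}"] ms[of "{0..1}"]
      by (simp add: \<zeta>_def emeasure_eq_measure)
  qed
  moreover have "measure \<zeta> {q<..1} = 0"
  proof -
    have "{0..1} = {0..q} \<union> {q<..1}" using q by auto
    then have "measure M {0..1} = measure M ({0..q} \<union> {q<..1})" by simp
    also have "\<dots> = measure M {0..q} + measure M {q<..1}" by (rule finite_measure_Union) auto
    finally have "measure M {q<..1} = 0" using Icc[of 1] Icc[of q] c1[of 1] c1[of q] q by simp
    moreover have "{q<..1} \<subseteq> {0..1}" using q by auto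
    ultimately show ?thesis using ms by simp
  qed
  ultimately show thesis
    using that[of \<zeta>] YmeasI[of \<zeta> q] sp st q ms Icc by auto
qed

text \<open>\<open>measure_of\<close> takes over the given set function only when it is a measure,
  so countable additivity of the combination has to be established first.\<close>

lemma emeasure_mix:
  assumes Y: "\<mu> \<in> Ymeas" "\<nu> \<in> Ymeas" and \<theta>: "0 \<le> \<theta>" "\<theta> \<le> 1" and A: "A \<in> sets \<mu>"
  shows "emeasure (mix \<theta> \<mu> \<nu>) A = ennreal (1 - \<theta>) * emeasure \<mu> A + ennreal \<theta> * emeasure \<nu> A"
  unfolding mix_def
proof (rule emeasure_measure_of_sigma[OF sets.sigma_algebra_axioms _ _ A])
  show "positive (sets \<mu>) (\<lambda>A. ennreal (1 - \<theta>) * emeasure \<mu> A + ennreal \<theta> * emeasure \<nu> A)"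
    by (simp add: positive_def)
  have st: "sets \<nu> = sets \<mu>" using YmeasD(3)[OF Y(1)] YmeasD(3)[OF Y(2)] by simp
  show "countably_additive (sets \<mu>) (\<lambda>A. ennreal (1 - \<theta>) * emeasure \<mu> A + ennreal \<theta> * emeasure \<nu> A)"
  proof (rule countably_additiveI)
    fix A :: "nat \<Rightarrow> real set"
    assume A: "range A \<subseteq> sets \<mu>" "disjoint_family A"
    have "(\<Sum>i. ennreal (1 - \<theta>) * emeasure \<mu> (A i) + ennreal \<theta> * emeasure \<nu> (A i)) =
        ennreal (1 - \<theta>) * (\<Sum>i. emeasure \<mu> (A i)) + ennreal \<theta> * (\<Sum>i. emeasure \<nu> (A i))"
      by (subst suminf_add[symmetric]) (auto simp: ennreal_suminf_cmult)
    then show "(\<Sum>i. ennreal (1 - \<theta>) * emeasure \<mu> (A i) + ennreal \<theta> * emeasure \<nu> (A i)) =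
        ennreal (1 - \<theta>) * emeasure \<mu> (\<Union>i. A i) + ennreal \<theta> * emeasure \<nu> (\<Union>i. A i)"
      using suminf_emeasure[OF A] suminf_emeasure[of A \<nu>] A st by simp
  qed
qed

lemma mix_Ymeas:
  assumes Y: "\<mu> \<in> Ymeas" "\<nu> \<in> Ymeas" and \<theta>: "0 \<le> \<theta>" "\<theta> \<le> 1"
  shows "mix \<theta> \<mu> \<nu> \<in> Ymeas"
    and "measure (mix \<theta> \<mu> \<nu>) A = (1 - \<theta>) * measure \<mu> A + \<theta> * measure \<nu> A"
proof -
  interpret m: prob_space \<mu> using YmeasD[OF Y(1)] by simp
  interpret n: prob_space \<nu> using YmeasD[OF Y(2)] by simp
  have sp: "space (mix \<theta> \<mu> \<nu>) = {0..1}" unfolding mix_def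
    using YmeasD(2)[OF Y(1)] by (simp add: space_measure_of_conv)
  have st: "sets (mix \<theta> \<mu> \<nu>) = sets \<mu>" unfolding mix_def
    by (simp add: sets.sets_measure_of_eq)
  have em: "emeasure (mix \<theta> \<mu> \<nu>) A = ennreal ((1 - \<theta>) * measure \<mu> A + \<theta> * measure \<nu> A)" if "A \<in> sets \<mu>" for A
    using emeasure_mix[OF Y \<theta> that] \<theta>
    by (simp add: m.emeasure_eq_measure n.emeasure_eq_measure ennreal_mult ennreal_plus)
  have ms: "measure (mix \<theta> \<mu> \<nu>) A = (1 - \<theta>) * measure \<mu> A + \<theta> * measure \<nu> A" for A
  proof (cases "A \<in> sets \<mu>")
    case True then show ?thesis using \<theta> by (intro measure_eq_emeasure_eq_ennreal em) auto
  next
    \<comment> \<open>Outside the sigma-algebra \<open>measure\<close> defaults to 0 for all three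
      measures, so the formula holds for every set.\<close>
    case False
    then have "A \<notin> sets \<nu>" using YmeasD(3)[OF Y(1)] YmeasD(3)[OF Y(2)] by simp
    then show ?thesis using False st by (simp add: measure_notin_sets)
  qed
  then show "measure (mix \<theta> \<mu> \<nu>) A = (1 - \<theta>) * measure \<mu> A + \<theta> * measure \<nu> A" .
  obtain q1 where q1: "0 < q1" "q1 < 1" "measure \<mu> {q1..1} = 0" using Ymeas_gap[OF Y(1)] .
  obtain q2 where q2: "0 < q2" "q2 < 1" "measure \<nu> {q2..1} = 0" using Ymeas_gap[OF Y(2)] .
  show "mix \<theta> \<mu> \<nu> \<in> Ymeas"
  proof (rule YmeasI[where q = "max q1 q2"])
    have "space \<mu> \<in> sets \<mu>" by simp
    then have "emeasure (mix \<theta> \<mu> \<nu>) {0..1} = 1"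
      using em[of "{0..1}"] m.prob_space n.prob_space YmeasD(2)[OF Y(1)] YmeasD(2)[OF Y(2)] by simp
    then show "prob_space (mix \<theta> \<mu> \<nu>)" using sp by (intro prob_spaceI) simp
    show "sets (mix \<theta> \<mu> \<nu>) = sets (restrict_space borel {0..1})" using st YmeasD(3)[OF Y(1)] by simp
    show "measure (mix \<theta> \<mu> \<nu>) {max q1 q2<..1} = 0"
      using ms Ymeas_gap_le[OF Y(1) _ q1(3), of "max q1 q2"] Ymeas_gap_le[OF Y(2) _ q2(3), of "max q1 q2"] q1 q2
      by simp
  qed (use sp q1 q2 in auto)
qed

lemma return_Ymeas:
  assumes s: "0 \<le> s" "s \<le> q" "q < 1"
  defines "\<eta> \<equiv> return (restrict_space borel {0..1}) s"
  shows "\<eta> \<in> Ymeas" "measure \<eta> {q<..1} = 0"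
proof -
  have e: "emeasure \<eta> {q<..1} = indicator {q<..1} s"
    unfolding \<eta>_def using s by (intro emeasure_return) (auto simp: sets_restrict_space_iff)
  then show m: "measure \<eta> {q<..1} = 0" using s by (simp add: measure_def)
  show "\<eta> \<in> Ymeas"
  proof (rule YmeasI[OF _ _ _ s(3) m])
    show "prob_space \<eta>" unfolding \<eta>_def using s by (intro prob_space_return) (simp add: space_restrict_space)
  qed (use s in \<open>auto simp: \<eta>_def space_restrict_space\<close>)
qed

text \<open>Fubini, with \<open>measure \<zeta> {0..v}\<close> written as the integral of the
  indicator of \<open>s \<le> v\<close>. It turns a pairing with the distribution function into an
  average of the primitive of \<open>\<phi>\<close>, which is how \<open>F\<close> gives rise to
  \<open>f\<close>. The minimum with \<open>q\<close> appears because \<open>\<phi>\<close> is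
  controlled only on [0, q].\<close>

lemma integral_cdf_mult:
  assumes Y: "\<zeta> \<in> Ymeas" and q: "0 < q" "q < 1" and \<phi>: "continuous_on {0..q} \<phi>"
  shows "integral {0..q} (\<lambda>v. measure \<zeta> {0..v} * \<phi> v) =
    integral {0..q} \<phi> - (\<integral>s. integral {0..min s q} \<phi> \<partial>\<zeta>)" (is ?eq)
    and "integrable \<zeta> (\<lambda>s. integral {0..min s q} \<phi>)" (is ?int)
proof -
  interpret prob_space \<zeta> using YmeasD[OF Y] by simp
  interpret P: pair_sigma_finite \<zeta> lborel by unfold_locales
  note id = Ymeas_measurable_ident[OF Y]
  define \<phi>' :: "real \<Rightarrow> real" where "\<phi>' v = indicator {0..q} v *\<^sub>R \<phi> v" for v
  have m: "\<phi>' \<in> borel_measurable borel" unfolding \<phi>'_def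
    by (rule borel_measurable_continuous_on_indicator[OF _ \<phi>]) simp
  define f where "f s v = indicator {s..} v * \<phi>' v" for s v :: real
  have I: "set_integrable lborel S \<phi>" if "S = {a..b}" "0 \<le> a" "b \<le> q" for S a b
    unfolding that(1) using that(2,3) by (intro borel_integrable_atLeastAtMost' continuous_on_subset[OF \<phi>]) auto
  have i\<phi>: "integrable lborel \<phi>'" using I[of "{0..q}" 0 q] unfolding set_integrable_def \<phi>'_def by simp
  have fm: "case_prod f \<in> borel_measurable (\<zeta> \<Otimes>\<^sub>M lborel)"
  proof -
    have 1: "(\<lambda>z. \<phi>' (snd z)) \<in> borel_measurable (\<zeta> \<Otimes>\<^sub>M lborel)"
      using measurable_compose[OF measurable_snd, of \<phi>' lborel borel \<zeta>] m by simp
    have [measurable]: "fst \<in> borel_measurable (\<zeta> \<Otimes>\<^sub>M lborel)"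
      using measurable_compose[OF measurable_fst id, of lborel] by simp
    have [measurable]: "snd \<in> borel_measurable (\<zeta> \<Otimes>\<^sub>M lborel)"
      using measurable_snd[of \<zeta> lborel] by simp
    have 2: "(\<lambda>z. if fst z \<le> snd z then \<phi>' (snd z) else 0) \<in> borel_measurable (\<zeta> \<Otimes>\<^sub>M lborel)"
      using 1 by measurable
    have "case_prod f = (\<lambda>z. if fst z \<le> snd z then \<phi>' (snd z) else 0)"
      by (auto simp: f_def indicator_def fun_eq_iff)
    then show ?thesis using 2 by simp
  qed
  have int: "integrable (\<zeta> \<Otimes>\<^sub>M lborel) (case_prod f)"
  proof (rule P.Fubini_integrable[OF fm])
    have "integrable lborel (f s)" for s
      using integrable_mult_indicator[OF _ i\<phi>, of "{s..}"] by (simp add: f_def[abs_def])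
    then show "AE s in \<zeta>. integrable lborel (\<lambda>v. case_prod f (s, v))" by simp
    have mm: "(\<lambda>s. \<integral>v. norm (f s v) \<partial>lborel) \<in> borel_measurable \<zeta>"
      using fm by (intro lborel.borel_measurable_lebesgue_integral) (simp add: case_prod_unfold)
    show "integrable \<zeta> (\<lambda>s. \<integral>v. norm (case_prod f (s, v)) \<partial>lborel)"
    proof (rule integrable_const_bound[where B = "\<integral>v. norm (\<phi>' v) \<partial>lborel"])
      have "(\<integral>v. norm (f s v) \<partial>lborel) \<le> (\<integral>v. norm (\<phi>' v) \<partial>lborel)" for s
      proof (rule integral_mono)
        show "integrable lborel (\<lambda>v. norm (f s v))" by (rule integrable_norm) fact
        show "integrable lborel (\<lambda>v. norm (\<phi>' v))" by (rule integrable_norm[OF i\<phi>])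
        show "norm (f s v) \<le> norm (\<phi>' v)" for v by (simp add: f_def indicator_def)
      qed
      then show "AE s in \<zeta>. norm (\<integral>v. norm (case_prod f (s, v)) \<partial>lborel) \<le> (\<integral>v. norm (\<phi>' v) \<partial>lborel)"
        by simp
    qed (use mm in simp)
  qed
  from P.Fubini_integral[OF int]
  have fub: "(\<integral>v. \<integral>s. f s v \<partial>\<zeta> \<partial>lborel) = (\<integral>s. \<integral>v. f s v \<partial>lborel \<partial>\<zeta>)" .
  have inner1: "(\<integral>s. f s v \<partial>\<zeta>) = indicator {0..q} v *\<^sub>R (measure \<zeta> {0..v} * \<phi> v)" for v
  proof (cases "v \<in> {0..q}")
    case True
    then have S: "{0..v} \<in> sets \<zeta>" using q by (auto simp: sets_Ymeas_iff[OF Y])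
    have "(\<integral>s. f s v \<partial>\<zeta>) = (\<integral>s. indicator {0..v} s * \<phi> v \<partial>\<zeta>)"
      using True YmeasD(2)[OF Y] by (intro Bochner_Integration.integral_cong) (auto simp: f_def \<phi>'_def indicator_def)
    then show ?thesis using True S by simp
  qed (simp add: f_def \<phi>'_def)
  have inner2: "(\<integral>v. f s v \<partial>lborel) = integral {0..q} \<phi> - integral {0..min s q} \<phi>" if s: "s \<in> space \<zeta>" for s
  proof -
    have s0: "0 \<le> s" using s YmeasD(2)[OF Y] by simp
    have "(\<integral>v. f s v \<partial>lborel) = (LINT v:{s..q}|lborel. \<phi> v)"
      unfolding set_lebesgue_integral_def using s0
      by (intro Bochner_Integration.integral_cong) (auto simp: f_def \<phi>'_def indicator_def)
    also have "\<dots> = integral {s..q} \<phi>" using I[of "{s..q}" s q] s0 by (intro set_borel_integral_eq_integral) auto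
    also have "\<dots> = integral {0..q} \<phi> - integral {0..min s q} \<phi>"
    proof (cases "s \<le> q")
      case True
      then show ?thesis
        using Henstock_Kurzweil_Integration.integral_combine[OF s0 True integrable_continuous_real[OF \<phi>]]
        by simp
    qed simp
    finally show ?thesis .
  qed
  have "integral {0..q} (\<lambda>v. measure \<zeta> {0..v} * \<phi> v) = (LINT v:{0..q}|lborel. measure \<zeta> {0..v} * \<phi> v)"
  proof (rule set_borel_integral_eq_integral(2)[symmetric])
    show "set_integrable lborel {0..q} (\<lambda>v. measure \<zeta> {0..v} * \<phi> v)"
      unfolding set_integrable_def inner1[symmetric] by (rule P.integrable_snd[OF int])
  qed
  also have "\<dots> = (\<integral>v. \<integral>s. f s v \<partial>\<zeta> \<partial>lborel)" unfolding set_lebesgue_integral_def inner1 ..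
  also have "\<dots> = (\<integral>s. integral {0..q} \<phi> - integral {0..min s q} \<phi> \<partial>\<zeta>)"
    unfolding fub by (rule Bochner_Integration.integral_cong) (auto simp: inner2)
  finally have eq: "integral {0..q} (\<lambda>v. measure \<zeta> {0..v} * \<phi> v) =
      (\<integral>s. integral {0..q} \<phi> - integral {0..min s q} \<phi> \<partial>\<zeta>)" .
  have "integrable \<zeta> (\<lambda>s. \<integral>v. f s v \<partial>lborel) \<longleftrightarrow>
      integrable \<zeta> (\<lambda>s. integral {0..q} \<phi> - integral {0..min s q} \<phi>)"
    by (rule Bochner_Integration.integrable_cong) (auto simp: inner2)
  then have "integrable \<zeta> (\<lambda>s. integral {0..q} \<phi> - integral {0..min s q} \<phi>)"
    using P.integrable_fst[OF int] by simp
  from Bochner_Integration.integrable_diff[OF integrable_const[of "integral {0..q} \<phi>"] this]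
  show ?int by simp
  then show ?eq unfolding eq by (simp add: prob_space)
qed

section \<open>Minimizers and concentration\<close>

lemma continuous_on_xi':
  assumes "\<exists>\<epsilon>>0. summable (\<lambda>p. (b p)\<^sup>2 * (1 + \<epsilon>) ^ p)"
  shows "continuous_on {0..1} (xi' b)"
proof -
  obtain \<epsilon> where \<epsilon>: "\<epsilon> > 0" "summable (\<lambda>p. (b p)\<^sup>2 * (1 + \<epsilon>) ^ p)" using assms by blast
  define c where "c p = (b p)\<^sup>2" for p
  have sc: "summable (\<lambda>p. c p * (1 + \<epsilon>) ^ p)" using \<epsilon>(2) by (simp add: c_def)
  have D: "xi' b x = (\<Sum>n. diffs c n * x ^ n)" if "\<bar>x\<bar> < 1 + \<epsilon>" for x
  proof -
    have "DERIV (xi b) x :> (\<Sum>n. diffs c n * x ^ n)"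
      unfolding xi_def[abs_def] c_def[symmetric] using termdiffs_strong[OF sc] that \<epsilon> by simp
    then show ?thesis unfolding xi'_def by (rule DERIV_imp_deriv)
  qed
  \<comment> \<open>A radius strictly between 1 and \<open>1 + \<epsilon>\<close>: the
    differentiated series still converges there, and the point 1 is interior to its disc, so
    continuity reaches the endpoint.\<close>
  have sd: "summable (\<lambda>n. diffs c n * (1 + \<epsilon> / 2) ^ n)"
  proof (rule termdiff_converges)
    show "norm (1 + \<epsilon> / 2) < 1 + \<epsilon>" using \<epsilon> by simp
    show "summable (\<lambda>n. c n * x ^ n)" if "norm x < 1 + \<epsilon>" for x
      by (rule powser_inside[OF sc]) (use that in simp)
  qed
  have "continuous_on {0..1} (\<lambda>x. \<Sum>n. diffs c n * x ^ n)"
    using \<epsilon>(1) by (intro continuous_at_imp_continuous_on ballI isCont_powser[OF sd]) auto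
  then show ?thesis
    by (rule continuous_on_eq) (use \<epsilon> in \<open>auto intro!: D[symmetric]\<close>)
qed

context parisi_functional
begin

text \<open>The tangent is taken at a mixture \<open>X n\<close> and evaluated at \<open>G\<close>.
  Since \<open>B q G \<le> B q (X n)\<close>, its slope towards \<open>G\<close> is nonpositive, so
  the slope towards \<open>H\<close> is nonnegative. Letting the mixtures tend to \<open>G\<close>
  gives the claim.\<close>

lemma first_order_condition:
  assumes G: "is_cdf q G" and H: "is_cdf q H"
    and min: "\<And>\<theta>. 0 < \<theta> \<Longrightarrow> \<theta> < 1 \<Longrightarrow> B q G \<le> B q (\<lambda>u. (1 - \<theta>) * G u + \<theta> * H u)"
  shows "0 \<le> integral {0..q} (\<lambda>v. F G v * (H v - G v))"
proof -
  note q = is_cdfD(1,2)[OF G]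
  \<comment> \<open>The shift by 2 keeps every weight strictly between 0 and 1, as
    \<open>min\<close> demands.\<close>
  define X where "X n u = (1 - 1 / real (n + 2)) * G u + 1 / real (n + 2) * H u" for n u
  have X: "is_cdf q (X n)" for n
  proof -
    have t: "0 \<le> 1 / real (n + 2)" "1 / real (n + 2) \<le> 1" by auto
    have "mono_on {0..1} (X n)"
    proof (rule mono_onI)
      fix r s :: real assume rs: "r \<in> {0..1}" "s \<in> {0..1}" "r \<le> s"
      then show "X n r \<le> X n s" unfolding X_def
        using t mono_onD[OF is_cdfD(3)[OF G] rs] mono_onD[OF is_cdfD(3)[OF H] rs]
        by (intro add_mono mult_left_mono) auto
    qed
    moreover have "0 \<le> X n u" if "u \<in> {0..1}" for u
      unfolding X_def using t is_cdfD(4)[OF G that] is_cdfD(4)[OF H that]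
      by (intro add_nonneg_nonneg mult_nonneg_nonneg) auto
    moreover have "X n u = 1" if "u \<in> {q..1}" for u
      unfolding X_def using is_cdfD(6)[OF G that] is_cdfD(6)[OF H that] by simp
    ultimately show ?thesis using q by (simp add: is_cdf_def)
  qed
  have i: "(\<lambda>v. F (X n) v * (H v - G v)) integrable_on {0..q}" for n
    using integrable_diff[OF F_mult_integrable[OF X H q(2)] F_mult_integrable[OF X G q(2)], of n n]
    by (simp add: right_diff_distrib mult.commute[of "F (X n) _"])
  have nn: "0 \<le> integral {0..q} (\<lambda>v. F (X n) v * (H v - G v))" for n
  proof -
    have "B q G \<le> B q (X n)"
      unfolding X_def using min[of "1 / real (n + 2)"] by simp
    moreover have "B q G \<ge> B q (X n) + \<beta>\<^sup>2 / 2 * integral {0..q} (\<lambda>v. F (X n) v * (G v - X n v))"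
      by (rule B_tangent(1)[OF X G])
    ultimately have "\<beta>\<^sup>2 / 2 * integral {0..q} (\<lambda>v. F (X n) v * (G v - X n v)) \<le> 0" by linarith
    moreover have "integral {0..q} (\<lambda>v. F (X n) v * (G v - X n v)) =
        integral {0..q} (\<lambda>v. - (1 / real (n + 2)) * (F (X n) v * (H v - G v)))"
      unfolding X_def by (intro integral_cong) (simp add: algebra_simps)
    moreover have "\<dots> = - (1 / real (n + 2)) * integral {0..q} (\<lambda>v. F (X n) v * (H v - G v))"
      by (rule integral_mult_right)
    ultimately have "0 \<le> (\<beta>\<^sup>2 / 2 * (1 / real (n + 2))) * integral {0..q} (\<lambda>v. F (X n) v * (H v - G v))"
      by simp
    moreover have "0 < \<beta>\<^sup>2 / 2 * (1 / real (n + 2))" using beta_pos by simp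
    ultimately show ?thesis by (simp only: zero_le_mult_iff) linarith
  qed
  obtain C where C: "\<And>G s. is_cdf q G \<Longrightarrow> s \<in> {0..q} \<Longrightarrow> \<bar>F G s\<bar> \<le> C"
    using F_bounded[OF q] by blast
  have t0: "(\<lambda>n. 1 / real (n + 2)) \<longlonglongrightarrow> 0"
    using LIMSEQ_ignore_initial_segment[OF lim_1_over_n, of 2] by simp
  have "X n u = G u + 1 / real (n + 2) * (H u - G u)" for n u
    unfolding X_def by (simp add: algebra_simps diff_divide_distrib)
  moreover have "(\<lambda>n. G u + 1 / real (n + 2) * (H u - G u)) \<longlonglongrightarrow> G u" for u
    by (rule tendsto_eq_intros t0 refl)+ simp
  ultimately have XG: "(\<lambda>n. X n u) \<longlonglongrightarrow> G u" for u by simp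
  have "(\<lambda>n. integral {0..q} (\<lambda>v. F (X n) v * (H v - G v))) \<longlonglongrightarrow> integral {0..q} (\<lambda>v. F G v * (H v - G v))"
  proof (rule dominated_convergence_negligible[OF i negligible_empty])
    show "\<bar>F (X n) v * (H v - G v)\<bar> \<le> C * 1" if "v \<in> {0..q}" for n v
    proof -
      have "\<bar>H v - G v\<bar> \<le> 1"
        using is_cdfD(4,5)[OF G, of v] is_cdfD(4,5)[OF H, of v] that q by auto
      then show ?thesis unfolding abs_mult using C[OF X that, of n] by (intro mult_mono) auto
    qed
    show "(\<lambda>n. F (X n) v * (H v - G v)) \<longlonglongrightarrow> F G v * (H v - G v)" if "v \<in> {0..q} - {}" for v
      using that by (intro tendsto_mult tendsto_const F_tendsto[OF X G negligible_empty] XG) auto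
  qed
  then show ?thesis by (rule LIMSEQ_le_const) (use nn in blast)
qed

end

section \<open>From \<open>B_fun\<close> and \<open>f_fun\<close> to distribution functions\<close>

locale torus_parisi = parisi_functional ls "K L d t" \<beta> h "xi' b"
  for ls :: "real list" and L d :: nat and t \<beta> h :: real and b :: "nat \<Rightarrow> real" +
  assumes ln_det: "\<And>u. u > 0 \<Longrightarrow> ln (det (massive_laplacian L d t u)) = (\<Sum>l\<leftarrow>ls. ln (u + l))"
    and length_ls: "length ls = L ^ d"
begin

abbreviation "cdf01 \<zeta> \<equiv> (\<lambda>u. measure \<zeta> {0..u})"

abbreviation "B' \<equiv> B_fun L d t \<beta> h b"
abbreviation "f_ext \<equiv> f_fun L d t \<beta> h b"

definition f :: "real measure \<Rightarrow> real \<Rightarrow> real" where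
  "f \<zeta> s = integral {0..s} (F (cdf01 \<zeta>))"

lemma delta_eq_tail: "delta \<zeta> s = tail (cdf01 \<zeta>) s"
  by (simp add: delta_def tail_def)

lemma B_at_eq:
  assumes "q < 1"
  shows "B_at L d t \<beta> h b q \<zeta> = B q (cdf01 \<zeta>)"
proof -
  have "\<beta> * (1 - q) > 0" using assms beta_pos by simp
  then show ?thesis
    unfolding B_at_def B_def delta_eq_tail using ln_det[OF pos] length_ls by simp
qed

text \<open>The cutoff picked by \<open>SOME\<close> is unknown, so it and the given
  \<open>q\<close> are both compared with their maximum through \<open>B_indep\<close>.\<close>

lemma B_fun_eq:
  assumes Y: "\<zeta> \<in> Ymeas" and q: "0 < q" "q < 1" "measure \<zeta> {q<..1} = 0"
  shows "B' \<zeta> = B q (cdf01 \<zeta>)"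
proof -
  define r where "r = (SOME q. 0 < q \<and> q < 1 \<and> measure \<zeta> {q..1} = 0)"
  have "\<exists>q. 0 < q \<and> q < 1 \<and> measure \<zeta> {q..1} = 0" using Ymeas_gap[OF Y] by metis
  then have r: "0 < r" "r < 1" "measure \<zeta> {r..1} = 0" unfolding r_def by (metis (mono_tags, lifting) someI_ex)+
  have cr: "is_cdf r (cdf01 \<zeta>)"
    using Ymeas_is_cdf[OF Y r(1,2)] Ymeas_gap_le[OF Y _ r(3), of r] r by simp
  have cq: "is_cdf q (cdf01 \<zeta>)" by (rule Ymeas_is_cdf[OF Y q])
  have "B' \<zeta> = B r (cdf01 \<zeta>)" unfolding B_fun_def r_def[symmetric] using r by (simp add: B_at_eq)
  also have "\<dots> = B (max q r) (cdf01 \<zeta>)" using q r by (intro B_indep[OF cr, symmetric]) auto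
  also have "\<dots> = B q (cdf01 \<zeta>)" using q r by (intro B_indep[OF cq]) auto
  finally show ?thesis .
qed

lemma common_gap:
  assumes "\<zeta> \<in> Ymeas" "\<eta> \<in> Ymeas"
  obtains q where "0 < q" "q < 1" "measure \<zeta> {q<..1} = 0" "measure \<eta> {q<..1} = 0"
proof -
  obtain q1 where q1: "0 < q1" "q1 < 1" "measure \<zeta> {q1..1} = 0" using Ymeas_gap[OF assms(1)] .
  obtain q2 where q2: "0 < q2" "q2 < 1" "measure \<eta> {q2..1} = 0" using Ymeas_gap[OF assms(2)] .
  show thesis
    using that[of "max q1 q2"] q1 q2 Ymeas_gap_le[OF assms(1) _ q1(3), of "max q1 q2"]
      Ymeas_gap_le[OF assms(2) _ q2(3), of "max q1 q2"] by simp
qed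

text \<open>\<open>deriv\<close> of \<open>K\<close> is identified only at positive arguments, and
  the tail is positive only before 1, hence the restriction on \<open>s\<close>.\<close>

lemma F_fun_eq:
  assumes Y: "\<zeta> \<in> Ymeas" and s: "s < 1"
  shows "F_fun L d t \<beta> h b \<zeta> s = F (cdf01 \<zeta>) s"
proof -
  obtain q where q: "0 < q" "q < 1" "measure \<zeta> {q<..1} = 0" using common_gap[OF Y Y] by metis
  note G = Ymeas_is_cdf[OF Y q]
  have K': "K' L d t (\<beta> * tail (cdf01 \<zeta>) u) = k' (\<beta> * tail (cdf01 \<zeta>) u)" if "0 \<le> u" "u < 1" for u
    unfolding K'_def by (rule deriv_k[OF scaled_tail_pos[OF G that]])
  have "integral {0..s} (\<lambda>u. K' L d t (\<beta> * tail (cdf01 \<zeta>) u)) = integral {0..s} (\<lambda>u. k' (\<beta> * tail (cdf01 \<zeta>) u))"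
    using K' s by (intro integral_cong) auto
  then show ?thesis unfolding F_fun_def F_def delta_eq_tail using K'[of 0] by simp
qed

lemma f_fun_eq:
  assumes Y: "\<zeta> \<in> Ymeas" and s: "s < 1"
  shows "f_ext \<zeta> s = ereal (f \<zeta> s)"
  unfolding f_fun_def f_def using s F_fun_eq[OF Y] by (auto intro!: integral_cong)

lemma continuous_on_f:
  assumes Y: "\<zeta> \<in> Ymeas"
  shows "continuous_on {0..<1} (f \<zeta>)"
proof -
  obtain q where q: "0 < q" "q < 1" "measure \<zeta> {q<..1} = 0" using common_gap[OF Y Y] by metis
  note G = Ymeas_is_cdf[OF Y q]
  show ?thesis unfolding continuous_on_eq_continuous_within
  proof
    fix x :: real assume x: "x \<in> {0..<1}"
    define a where "a = (x + 1) / 2"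
    have a: "x < a" "a < 1" using x by (auto simp: a_def)
    have "continuous_on {0..a} (f \<zeta>)" unfolding f_def
      by (intro indefinite_integral_continuous_1 integrable_continuous_real continuous_on_F[OF G a(2)])
    then have "continuous (at x within {0..a}) (f \<zeta>)"
      using x a by (auto simp: continuous_on_eq_continuous_within)
    moreover have "at x within {0..a} = at x within {0..<1}"
      by (rule at_within_nhd[of x "{..<a}"]) (use a in auto)
    ultimately show "continuous (at x within {0..<1}) (f \<zeta>)" by simp
  qed
qed

text \<open>The supremum runs over the open interval, while measures may charge the endpoints. At 1
  the value is minus infinity; at 0 the value is a limit from the right.\<close>

lemma f_fun_le_SUP:
  assumes Y: "\<zeta> \<in> Ymeas" and s: "s \<in> {0..1}"
  shows "f_ext \<zeta> s \<le> (SUP s'\<in>{0<..<1}. f_ext \<zeta> s')"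
proof -
  consider "s = 1" | "0 < s" "s < 1" | "s = 0" using s by force
  then show ?thesis
  proof cases
    case 1 then show ?thesis by (simp add: f_fun_def)
  next
    case 2 then show ?thesis by (intro SUP_upper) auto
  next
    case 3
    have "(f \<zeta> \<longlongrightarrow> f \<zeta> 0) (at 0 within {0..<1})"
      using continuous_on_f[OF Y] by (simp add: continuous_on_def)
    moreover have "at 0 within {0..<1} = (at_right 0 :: real filter)"
      by (rule at_within_nhd[of 0 "{..<1}"]) auto
    ultimately have "(f \<zeta> \<longlongrightarrow> f \<zeta> 0) (at_right 0)" by simp
    then have "((\<lambda>s. ereal (f \<zeta> s)) \<longlongrightarrow> ereal (f \<zeta> 0)) (at_right 0)" by simp
    moreover have "\<forall>\<^sub>F s in at_right 0. ereal (f \<zeta> s) \<le> (SUP s'\<in>{0<..<1}. f_ext \<zeta> s')"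
      unfolding eventually_at_right_field
    proof (intro exI[of _ 1] conjI allI impI)
      fix y :: real assume "0 < y" "y < 1"
      then show "ereal (f \<zeta> y) \<le> (SUP s'\<in>{0<..<1}. f_ext \<zeta> s')"
        using f_fun_eq[OF Y, of y] by (intro SUP_upper2[of y]) auto
    qed simp
    ultimately have "ereal (f \<zeta> 0) \<le> (SUP s'\<in>{0<..<1}. f_ext \<zeta> s')"
      by (rule tendsto_upperbound) simp
    then show ?thesis using 3 f_fun_eq[OF Y, of 0] by simp
  qed
qed

lemma AE_le_gap:
  assumes Y: "\<zeta> \<in> Ymeas" and q: "0 \<le> q" "measure \<zeta> {q<..1} = 0"
  shows "AE s in \<zeta>. s \<in> {0..q}"
proof -
  interpret prob_space \<zeta> using YmeasD[OF Y] by simp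
  have "{q<..1} \<in> null_sets \<zeta>"
    using q by (auto simp: null_sets_def emeasure_eq_measure sets_Ymeas_iff[OF Y])
  then have "AE s in \<zeta>. s \<notin> {q<..1}" by (rule AE_not_in)
  moreover have "AE s in \<zeta>. s \<in> {0..1}" using AE_space[of \<zeta>] YmeasD(2)[OF Y] by simp
  ultimately show ?thesis by eventually_elim auto
qed

text \<open>The slope from \<zeta> towards \<eta> becomes a difference of two averages of the same
  function, so it is decided by where \<zeta> and \<eta> put their mass. The minimum with
  \<open>q\<close> is harmless because both measures live on [0, q].\<close>

lemma integral_f:
  assumes Y: "\<zeta> \<in> Ymeas" "\<eta> \<in> Ymeas" and q: "0 < q" "q < 1" "measure \<zeta> {q<..1} = 0" "measure \<eta> {q<..1} = 0"
  shows "integral {0..q} (\<lambda>v. F (cdf01 \<zeta>) v * (cdf01 \<eta> v - cdf01 \<zeta> v)) =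
      (\<integral>s. f \<zeta> (min s q) \<partial>\<zeta>) - (\<integral>s. f \<zeta> (min s q) \<partial>\<eta>)"
    and "integrable \<eta> (\<lambda>s. f \<zeta> (min s q))"
proof -
  note G = Ymeas_is_cdf[OF Y(1) q(1,2,3)] and H = Ymeas_is_cdf[OF Y(2) q(1,2,4)]
  note c = continuous_on_F[OF G q(2)]
  note i1 = integral_cdf_mult[OF Y(1) q(1,2) c] and i2 = integral_cdf_mult[OF Y(2) q(1,2) c]
  have "integral {0..q} (\<lambda>v. F (cdf01 \<zeta>) v * (cdf01 \<eta> v - cdf01 \<zeta> v)) =
      integral {0..q} (\<lambda>v. cdf01 \<eta> v * F (cdf01 \<zeta>) v - cdf01 \<zeta> v * F (cdf01 \<zeta>) v)"
    by (intro integral_cong) (simp add: algebra_simps)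
  also have "\<dots> = integral {0..q} (\<lambda>v. cdf01 \<eta> v * F (cdf01 \<zeta>) v) - integral {0..q} (\<lambda>v. cdf01 \<zeta> v * F (cdf01 \<zeta>) v)"
    by (intro integral_diff F_mult_integrable[OF G H q(2)] F_mult_integrable[OF G G q(2)])
  finally show "integral {0..q} (\<lambda>v. F (cdf01 \<zeta>) v * (cdf01 \<eta> v - cdf01 \<zeta> v)) =
      (\<integral>s. f \<zeta> (min s q) \<partial>\<zeta>) - (\<integral>s. f \<zeta> (min s q) \<partial>\<eta>)"
    unfolding i1(1) i2(1) f_def by simp
  show "integrable \<eta> (\<lambda>s. f \<zeta> (min s q))" unfolding f_def by (rule i2(2))
qed

text \<open>Distinct measures have distinct distribution functions, and by right continuity distinct
  tails, which is the condition for strictness in \<open>B_tangent\<close>.\<close>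

lemma strict_tangent:
  assumes Y: "\<zeta> \<in> Ymeas" "\<eta> \<in> Ymeas" and q: "0 < q" "q < 1" "measure \<zeta> {q<..1} = 0" "measure \<eta> {q<..1} = 0"
    and ne: "\<zeta> \<noteq> \<eta>"
  shows "B' \<eta> > B' \<zeta> + \<beta>\<^sup>2 / 2 * integral {0..q} (\<lambda>v. F (cdf01 \<zeta>) v * (cdf01 \<eta> v - cdf01 \<zeta> v))"
proof -
  note G = Ymeas_is_cdf[OF Y(1) q(1,2,3)] and H = Ymeas_is_cdf[OF Y(2) q(1,2,4)]
  have "\<exists>s\<in>{0..q}. tail (cdf01 \<zeta>) s \<noteq> tail (cdf01 \<eta>) s"
  proof (rule ccontr)
    assume "\<not> ?thesis"
    then have "cdf01 \<zeta> u = cdf01 \<eta> u" if "u \<in> {0..1}" for u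
      using tail_inj[OF G H Ymeas_cdf_right_continuous[OF Y(1)] Ymeas_cdf_right_continuous[OF Y(2)] _ that]
      by blast
    then show False using ne Ymeas_eqI[OF Y] by blast
  qed
  from B_tangent(2)[OF G H this] show ?thesis
    using B_fun_eq[OF Y(1) q(1,2,3)] B_fun_eq[OF Y(2) q(1,2,4)] by simp
qed

lemma strictly_convex_B: "strictly_convex_on_measures Ymeas B'"
  unfolding strictly_convex_on_measures_def
proof (intro ballI allI impI)
  fix \<mu> \<nu> and \<theta> :: real
  assume Y: "\<mu> \<in> Ymeas" "\<nu> \<in> Ymeas" and \<theta>: "0 < \<theta> \<and> \<theta> < 1"
  let ?X = "mix \<theta> \<mu> \<nu>"
  have X: "?X \<in> Ymeas" and ms: "\<And>A. measure ?X A = (1 - \<theta>) * measure \<mu> A + \<theta> * measure \<nu> A"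
    using mix_Ymeas[OF Y] \<theta> by auto
  have "B' ?X < (1 - \<theta>) * B' \<mu> + \<theta> * B' \<nu>" if ne: "\<mu> \<noteq> \<nu>"
  proof -
    obtain q where q: "0 < q" "q < 1" "measure \<mu> {q<..1} = 0" "measure \<nu> {q<..1} = 0"
      using common_gap[OF Y] .
    have qX: "measure ?X {q<..1} = 0" using q ms by simp
    have "\<exists>u\<in>{0..1}. cdf01 \<mu> u \<noteq> cdf01 \<nu> u" using Ymeas_eqI[OF Y] ne by blast
    then obtain u where u: "cdf01 \<mu> u \<noteq> cdf01 \<nu> u" by blast
    \<comment> \<open>Seen from the mixture, both end points lie along the same direction with
      coefficients \<open>- \<theta>\<close> and \<open>1 - \<theta>\<close>. In the weighted sum of
      the two tangent inequalities the slopes cancel.\<close>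
    have d: "cdf01 ?X v - cdf01 \<mu> v = \<theta> * (cdf01 \<nu> v - cdf01 \<mu> v)"
      "cdf01 \<mu> v - cdf01 ?X v = - \<theta> * (cdf01 \<nu> v - cdf01 \<mu> v)"
      "cdf01 \<nu> v - cdf01 ?X v = (1 - \<theta>) * (cdf01 \<nu> v - cdf01 \<mu> v)" for v
      unfolding ms by (auto simp: algebra_simps)
    have "?X \<noteq> \<mu>" "?X \<noteq> \<nu>" using d(1)[of u] d(3)[of u] u \<theta> by auto
    note t1 = strict_tangent[OF X Y(1) q(1,2) qX q(3) this(1)]
      and t2 = strict_tangent[OF X Y(2) q(1,2) qX q(4) this(2)]
    define I where "I = integral {0..q} (\<lambda>v. F (cdf01 ?X) v * (cdf01 \<nu> v - cdf01 \<mu> v))"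
    have "integral {0..q} (\<lambda>v. F (cdf01 ?X) v * (cdf01 \<mu> v - cdf01 ?X v)) = - \<theta> * I"
      unfolding d I_def by (subst integral_mult_right[symmetric]) (simp add: mult_ac)
    moreover have "integral {0..q} (\<lambda>v. F (cdf01 ?X) v * (cdf01 \<nu> v - cdf01 ?X v)) = (1 - \<theta>) * I"
      unfolding d I_def by (subst integral_mult_right[symmetric]) (simp add: mult_ac)
    ultimately have t: "B' \<mu> > B' ?X - \<theta> * (\<beta>\<^sup>2 / 2 * I)" "B' \<nu> > B' ?X + (1 - \<theta>) * (\<beta>\<^sup>2 / 2 * I)"
      using t1 t2 by (simp_all add: mult_ac)
    have "(1 - \<theta>) * B' \<mu> + \<theta> * B' \<nu> >
        (1 - \<theta>) * (B' ?X - \<theta> * (\<beta>\<^sup>2 / 2 * I)) + \<theta> * (B' ?X + (1 - \<theta>) * (\<beta>\<^sup>2 / 2 * I))"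
      using t \<theta> by (intro add_strict_mono mult_strict_left_mono) auto
    then show ?thesis by (simp add: algebra_simps)
  qed
  then show "?X \<in> Ymeas \<and> (\<mu> \<noteq> \<nu> \<longrightarrow> B' ?X < (1 - \<theta>) * B' \<mu> + \<theta> * B' \<nu>)" using X by blast
qed

text \<open>The average of \<open>f \<zeta>\<close> under \<zeta> is its maximum, which no other
  measure can exceed, so the slope towards every \<eta> is nonnegative and the strict tangent
  inequality finishes.\<close>

lemma concentrated_strict_minimizer:
  assumes Y: "\<zeta> \<in> Ymeas" "\<eta> \<in> Ymeas" and ne: "\<zeta> \<noteq> \<eta>"
    and c: "concentrated_on_maximizers L d t \<beta> h b \<zeta>"
  shows "B' \<zeta> < B' \<eta>"
proof -
  interpret z: prob_space \<zeta> using YmeasD[OF Y(1)] by simp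
  interpret e: prob_space \<eta> using YmeasD[OF Y(2)] by simp
  define W where "W = (SUP s'\<in>{0<..<1}. f_ext \<zeta> s')"
  define S where "S = {s \<in> {0..1}. f_ext \<zeta> s = W}"
  have S: "measure \<zeta> S = 1" using c unfolding concentrated_on_maximizers_def S_def W_def .
  then have "S \<noteq> {}" by auto
  then obtain s0 where s0: "s0 \<in> S" by blast
  \<comment> \<open>Any interior point shows that the supremum is not minus infinity, so the point 1
    is not a maximizer and \<open>f\<close> is finite on \<open>S\<close>.\<close>
  have "W \<ge> f_ext \<zeta> (1/2)" unfolding W_def by (rule f_fun_le_SUP[OF Y(1)]) simp
  then have "W \<noteq> - \<infinity>" using f_fun_eq[OF Y(1), of "1/2"] by auto
  then have lt: "s < 1" if "s \<in> S" for s using that by (auto simp: S_def f_fun_def split: if_splits)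
  define M where "M = f \<zeta> s0"
  have W: "W = ereal M" using s0 f_fun_eq[OF Y(1) lt[OF s0]] by (simp add: S_def M_def)
  have M: "f \<zeta> s = M" if "s \<in> S" for s
    using that f_fun_eq[OF Y(1) lt[OF that]] W by (simp add: S_def)
  have le: "f \<zeta> s \<le> M" if "s \<in> {0..<1}" for s
    using f_fun_le_SUP[OF Y(1), of s] f_fun_eq[OF Y(1), of s] that W unfolding W_def by auto
  obtain q where q: "0 < q" "q < 1" "measure \<zeta> {q<..1} = 0" "measure \<eta> {q<..1} = 0"
    using common_gap[OF Y] .
  have "AE s in \<zeta>. f \<zeta> (min s q) \<ge> M"
  proof -
    have "AE s in \<zeta>. s \<in> S" using z.AE_prob_1[OF S] .
    with AE_le_gap[OF Y(1) _ q(3)] q show ?thesis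
      by (auto elim!: eventually_elim2 simp: min_absorb1 M)
  qed
  then have "(\<integral>s. f \<zeta> (min s q) \<partial>\<zeta>) \<ge> M"
    by (intro z.integral_ge_const integral_f(2)[OF Y(1) Y(1) q(1-3) q(3)])
  moreover have "(\<integral>s. f \<zeta> (min s q) \<partial>\<eta>) \<le> M"
  proof (rule e.integral_le_const[OF integral_f(2)[OF Y q]])
    show "AE s in \<eta>. f \<zeta> (min s q) \<le> M"
      using AE_le_gap[OF Y(2) _ q(4)] q by (auto elim!: eventually_mono intro!: le)
  qed
  ultimately have "integral {0..q} (\<lambda>v. F (cdf01 \<zeta>) v * (cdf01 \<eta> v - cdf01 \<zeta> v)) \<ge> 0"
    unfolding integral_f(1)[OF Y q] by simp
  then have "\<beta>\<^sup>2 / 2 * integral {0..q} (\<lambda>v. F (cdf01 \<zeta>) v * (cdf01 \<eta> v - cdf01 \<zeta> v)) \<ge> 0" by simp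
  then show ?thesis using strict_tangent[OF Y q ne] by linarith
qed

section \<open>Existence of a minimizer and its concentration\<close>

lemma exists_minimizer:
  assumes q: "0 < q" "q < 1"
  obtains \<zeta> where "\<zeta> \<in> Ymeas" "measure \<zeta> {q<..1} = 0"
    "\<And>\<eta>. \<eta> \<in> Ymeas \<Longrightarrow> measure \<eta> {q<..1} = 0 \<Longrightarrow> B q (cdf01 \<zeta>) \<le> B q (cdf01 \<eta>)"
proof -
  define Y where "Y = {\<zeta> \<in> Ymeas. measure \<zeta> {q<..1} = 0}"
  \<comment> \<open>In the extended reals the infimum exists without a lower bound for
    \<open>B\<close>. Its finiteness comes out at the end, since it is a value of
    \<open>\<Phi>\<close>.\<close>
  define \<Phi> where "\<Phi> \<zeta> = ereal (B q (cdf01 \<zeta>))" for \<zeta>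
  have cdfY: "is_cdf q (cdf01 \<zeta>)" if "\<zeta> \<in> Y" for \<zeta>
    using that Ymeas_is_cdf[OF _ q] unfolding Y_def by simp
  have "return (restrict_space borel {0..1}) 0 \<in> Y"
    using return_Ymeas[of 0 q] q unfolding Y_def by simp
  then have "Y \<noteq> {}" by blast
  then obtain v where v: "\<And>n. v n \<in> \<Phi> ` Y" "v \<longlonglongrightarrow> Inf (\<Phi> ` Y)"
    using Inf_as_limit[of "\<Phi> ` Y"] by blast
  then have "\<forall>n. \<exists>\<zeta>\<in>Y. v n = \<Phi> \<zeta>" by blast
  then obtain \<zeta>n where \<zeta>n: "\<And>n. \<zeta>n n \<in> Y" "\<And>n. v n = \<Phi> (\<zeta>n n)" by metis
  have Yn: "\<zeta>n n \<in> Ymeas" for n using \<zeta>n(1) by (simp add: Y_def)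
  define \<mu> where "\<mu> n = extend_borel (\<zeta>n n)" for n
  have rd: "real_distribution (\<mu> n)" for n unfolding \<mu>_def by (rule real_distribution_extend_borel[OF Yn])
  have cdf0: "cdf (\<mu> n) u = 0" if "u < 0" for n u
    unfolding \<mu>_def using cdf_extend_borel(1)[OF Yn that] .
  have cdf1: "cdf (\<mu> n) u = 1" if "u \<ge> q" for n u
    using cdf_extend_borel(2,3)[OF Yn, of u n] is_cdfD(6)[OF cdfY[OF \<zeta>n(1)], of u n] that q
    unfolding \<mu>_def by (cases "u \<le> 1") auto
  have "tight \<mu>" unfolding tight_def
  proof (intro conjI allI impI rd)
    fix \<epsilon> :: real assume \<epsilon>: "\<epsilon> > 0"
    \<comment> \<open>The left end lies below 0 because the interval is open there and 0 may carry
      an atom.\<close>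
    have "measure (\<mu> n) {-1<..1} = 1" for n
    proof -
      interpret real_distribution "\<mu> n" by (rule rd)
      show ?thesis using cdf_diff_eq[of "-1" 1] cdf0[of "-1" n] cdf1[of 1 n] q by simp
    qed
    then show "\<exists>a b. a < b \<and> (\<forall>n. 1 - \<epsilon> < measure (\<mu> n) {a<..b})"
      using \<epsilon> by (intro exI[of _ "-1"] exI[of _ 1]) auto
  qed
  then obtain r M where r: "strict_mono r" and M: "real_distribution M" and w: "weak_conv_m (\<mu> \<circ> id \<circ> r) M"
    using tight_imp_convergent_subsubsequence[of \<mu> id] by (auto simp: strict_mono_id)
  interpret M: real_distribution M by fact
  have lim: "(\<lambda>n. cdf (\<mu> (r n)) x) \<longlonglongrightarrow> cdf M x" if "isCont (cdf M) x" for x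
    using w that by (simp add: weak_conv_m_def weak_conv_def)
  define S where "S = {x. \<not> isCont (cdf M) x}"
  have S: "countable S" unfolding S_def
    by (rule mono_ctble_discont) (use M.cdf_nondecreasing in \<open>auto simp: mono_def\<close>)
  \<comment> \<open>Continuity points of the limit are dense, so its values below 0 and above
    \<open>q\<close> can be read off the sequence.\<close>
  have cont: "\<exists>c. x < c \<and> c < y \<and> isCont (cdf M) c" if "x < y" for x y
  proof (rule ccontr)
    assume "\<not> ?thesis"
    then have "{x<..<y} \<subseteq> S" by (auto simp: S_def)
    from countable_subset[OF this S] show False using uncountable_open_interval[of x y] that by simp
  qed
  have M0: "cdf M u = 0" if u: "u < 0" for u
  proof -
    obtain c where c: "u < c" "c < 0" "isCont (cdf M) c" using cont[OF u] by blast
    have "cdf M c = 0" using lim[OF c(3)] cdf0[OF c(2)] by (simp add: LIMSEQ_const_iff)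
    then show ?thesis using M.cdf_nondecreasing[of u c] c M.cdf_nonneg[of u] by simp
  qed
  have M1: "cdf M u = 1" if u: "u > q" for u
  proof -
    obtain c where c: "q < c" "c < u" "isCont (cdf M) c" using cont[OF u] by blast
    have "cdf M c = 1" using lim[OF c(3)] cdf1[of c] c(1) by (simp add: LIMSEQ_const_iff)
    then show ?thesis using M.cdf_nondecreasing[of c u] c M.cdf_bounded_prob[of u] by simp
  qed
  \<comment> \<open>At \<open>q\<close> itself the limit may jump, so the value 1 is obtained from
    the right.\<close>
  have "(cdf M \<longlongrightarrow> cdf M q) (at_right q)"
    using M.cdf_is_right_cont[of q] by (simp add: continuous_within)
  moreover have "(cdf M \<longlongrightarrow> 1) (at_right q)"
    by (rule tendsto_eventually) (auto simp: eventually_at_right_field M1 intro!: exI[of _ "q + 1"])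
  ultimately have Mq: "cdf M q = 1" using tendsto_unique[OF trivial_limit_at_right_real] by blast
  obtain \<zeta> where \<zeta>: "\<zeta> \<in> Ymeas" "measure \<zeta> {q<..1} = 0" "\<And>u. u \<in> {0..1} \<Longrightarrow> measure \<zeta> {0..u} = cdf M u"
    using Ymeas_of_distribution[OF M _ q(2) M0 Mq] q by auto
  have "(\<lambda>n. B q (cdf01 (\<zeta>n (r n)))) \<longlonglongrightarrow> B q (cdf01 \<zeta>)"
  proof (rule B_tendsto[OF cdfY[OF \<zeta>n(1)] Ymeas_is_cdf[OF \<zeta>(1) q \<zeta>(2)]])
    have "negligible (\<Union>x\<in>S. {x})" by (rule negligible_countable_Union) (use S in auto)
    then show "negligible S" by simp
    show "(\<lambda>n. cdf01 (\<zeta>n (r n)) x) \<longlonglongrightarrow> cdf01 \<zeta> x" if "x \<in> {0..1} - S" for x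
      using lim[of x] that \<zeta>(3)[of x] cdf_extend_borel(2)[OF Yn, of x] by (simp add: S_def \<mu>_def)
  qed
  then have "(v \<circ> r) \<longlonglongrightarrow> \<Phi> \<zeta>" unfolding comp_def \<zeta>n(2) \<Phi>_def by simp
  moreover have "(v \<circ> r) \<longlonglongrightarrow> Inf (\<Phi> ` Y)" by (rule LIMSEQ_subseq_LIMSEQ[OF v(2) r])
  ultimately have I: "\<Phi> \<zeta> = Inf (\<Phi> ` Y)" by (rule LIMSEQ_unique)
  show thesis
  proof (rule that[OF \<zeta>(1,2)])
    fix \<eta> assume "\<eta> \<in> Ymeas" "measure \<eta> {q<..1} = 0"
    then have "\<Phi> \<zeta> \<le> \<Phi> \<eta>" unfolding I by (intro INF_lower) (simp add: Y_def)
    then show "B q (cdf01 \<zeta>) \<le> B q (cdf01 \<eta>)" by (simp add: \<Phi>_def)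
  qed
qed

text \<open>\<open>q\<close> comes from \<open>F_negative_near_1\<close> before any measure is
  chosen, so there is no circularity in applying the negativity of \<open>F\<close> to the minimizer
  on [0, q].\<close>

lemma exists_concentrated: "\<exists>\<zeta>\<in>Ymeas. concentrated_on_maximizers L d t \<beta> h b \<zeta>"
proof -
  obtain q where q: "0 < q" "q < 1" and neg: "\<And>q' G s. is_cdf q' G \<Longrightarrow> s \<in> {q..<1} \<Longrightarrow> F G s < 0"
    using F_negative_near_1 by blast
  obtain \<zeta> where \<zeta>: "\<zeta> \<in> Ymeas" "measure \<zeta> {q<..1} = 0"
    and min: "\<And>\<eta>. \<eta> \<in> Ymeas \<Longrightarrow> measure \<eta> {q<..1} = 0 \<Longrightarrow> B q (cdf01 \<zeta>) \<le> B q (cdf01 \<eta>)"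
    using exists_minimizer[OF q] by blast
  interpret prob_space \<zeta> using YmeasD[OF \<zeta>(1)] by simp
  note G = Ymeas_is_cdf[OF \<zeta>(1) q \<zeta>(2)]
  note int = integral_f(2)[OF \<zeta>(1) \<zeta>(1) q \<zeta>(2) \<zeta>(2)]
  define M where "M = (\<integral>s. f \<zeta> (min s q) \<partial>\<zeta>)"
  have le_q: "f \<zeta> s \<le> M" if s: "s \<in> {0..q}" for s
  proof -
    define \<eta> where "\<eta> = return (restrict_space borel {0..1}) s"
    have \<eta>: "\<eta> \<in> Ymeas" "measure \<eta> {q<..1} = 0" unfolding \<eta>_def using return_Ymeas[of s q] s q by auto
    have "0 \<le> integral {0..q} (\<lambda>v. F (cdf01 \<zeta>) v * (cdf01 \<eta> v - cdf01 \<zeta> v))"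
    proof (rule first_order_condition[OF G Ymeas_is_cdf[OF \<eta>(1) q \<eta>(2)]])
      fix \<theta> :: real assume "0 < \<theta>" "\<theta> < 1"
      then have X: "mix \<theta> \<zeta> \<eta> \<in> Ymeas"
        and ms: "\<And>A. measure (mix \<theta> \<zeta> \<eta>) A = (1 - \<theta>) * measure \<zeta> A + \<theta> * measure \<eta> A"
        using mix_Ymeas[OF \<zeta>(1) \<eta>(1)] by auto
      have "measure (mix \<theta> \<zeta> \<eta>) {q<..1} = 0" using ms \<zeta>(2) \<eta>(2) by simp
      from min[OF X this] show "B q (cdf01 \<zeta>) \<le> B q (\<lambda>u. (1 - \<theta>) * cdf01 \<zeta> u + \<theta> * cdf01 \<eta> u)"
        by (simp add: ms)
    qed
    then have "(\<integral>r. f \<zeta> (min r q) \<partial>\<eta>) \<le> M"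
      unfolding integral_f(1)[OF \<zeta>(1) \<eta>(1) q \<zeta>(2) \<eta>(2)] M_def by simp
    moreover have "(\<integral>r. f \<zeta> (min r q) \<partial>\<eta>) = f \<zeta> (min s q)"
      unfolding \<eta>_def
    proof (rule integral_return)
      show "s \<in> space (restrict_space borel {0..1})" using s q by (simp add: space_restrict_space)
      show "(\<lambda>r. f \<zeta> (min r q)) \<in> borel_measurable (restrict_space borel {0..1})"
        using borel_measurable_integrable[OF int] measurable_cong_sets[OF YmeasD(3)[OF \<zeta>(1)] refl] by blast
    qed
    ultimately show ?thesis using s by simp
  qed
  have le: "f \<zeta> s \<le> M" if s: "s \<in> {0..<1}" for s
  proof (cases "s \<le> q")
    case False
    have i: "F (cdf01 \<zeta>) integrable_on {0..s}"
      using s by (intro integrable_continuous_real continuous_on_F[OF G]) auto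
    have "integral {q..s} (F (cdf01 \<zeta>)) \<le> integral {q..s} (\<lambda>_. 0)"
    proof (rule integral_le)
      show "F (cdf01 \<zeta>) integrable_on {q..s}"
        by (rule integrable_on_subinterval[OF i]) (use q in auto)
      show "F (cdf01 \<zeta>) x \<le> 0" if "x \<in> {q..s}" for x using neg[OF G, of x] that s by auto
    qed (rule integrable_0)
    then have "f \<zeta> s \<le> f \<zeta> q"
      unfolding f_def using Henstock_Kurzweil_Integration.integral_combine[OF _ _ i, of q] q False by simp
    then show ?thesis using le_q[of q] q by simp
  qed (use le_q s in auto)
  have AE_q: "AE s in \<zeta>. s \<in> {0..q}" using AE_le_gap[OF \<zeta>(1) _ \<zeta>(2)] q by simp
  have int': "integrable \<zeta> (\<lambda>s. M - f \<zeta> (min s q))"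
    using int by (intro Bochner_Integration.integrable_diff) auto
  \<comment> \<open>\<open>M\<close> is both an upper bound of \<open>f \<zeta>\<close> and its
    average, so \<open>f \<zeta>\<close> equals \<open>M\<close> almost everywhere.\<close>
  have "AE s in \<zeta>. 0 \<le> M - f \<zeta> (min s q)"
    using AE_q by eventually_elim (use le_q in \<open>auto simp: min_absorb1\<close>)
  moreover have "(\<integral>s. M - f \<zeta> (min s q) \<partial>\<zeta>) = 0"
    using int by (simp add: M_def prob_space)
  ultimately have "AE s in \<zeta>. M - f \<zeta> (min s q) = 0"
    using integral_nonneg_eq_0_iff_AE[OF int'] by blast
  then have AE_M: "AE s in \<zeta>. s \<in> {0..q} \<and> f \<zeta> s = M"
    using AE_q by eventually_elim (auto simp: min_absorb1)
  have "\<exists>s. s \<in> {0..q} \<and> f \<zeta> s = M"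
  proof (rule ccontr)
    assume *: "\<not> ?thesis"
    from AE_M have "AE s in \<zeta>. False" by (rule eventually_mono) (use * in blast)
    then show False by simp
  qed
  then obtain s0 where s0: "s0 \<in> {0..q}" "f \<zeta> s0 = M" by blast
  define W where "W = (SUP s'\<in>{0<..<1}. f_ext \<zeta> s')"
  have "W = ereal M"
  proof (rule antisym)
    show "W \<le> ereal M" unfolding W_def
      using f_fun_eq[OF \<zeta>(1)] le by (intro SUP_least) auto
    show "ereal M \<le> W"
      using f_fun_le_SUP[OF \<zeta>(1), of s0] f_fun_eq[OF \<zeta>(1), of s0] s0 q by (simp add: W_def)
  qed
  then have eq: "{s \<in> {0..1}. f_ext \<zeta> s = W} =
      {s \<in> space \<zeta>. s < 1 \<and> f \<zeta> s = M}"
    using f_fun_eq[OF \<zeta>(1)] YmeasD(2)[OF \<zeta>(1)] by (auto simp: f_fun_def split: if_splits)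
  \<comment> \<open>Measurability of the set of maximizers: \<open>f \<zeta>\<close> is known to be
    continuous only on [0, 1), so it is cut off outside. Intersecting with that interval again
    matters when \<open>M = 0\<close>, since the cut-off function is 0 outside.\<close>
  have "(\<lambda>s. indicator {0..<1} s *\<^sub>R f \<zeta> s) \<in> borel_measurable borel"
    by (rule borel_measurable_continuous_on_indicator[OF _ continuous_on_f[OF \<zeta>(1)]]) simp
  then have "{s \<in> space borel. indicator {0..<1} s *\<^sub>R f \<zeta> s = M} \<in> sets borel" by measurable
  then have A: "{s. indicator {0..<1} s *\<^sub>R f \<zeta> s = M} \<inter> {0..<1} \<in> sets borel" by simp
  have E: "{s. indicator {0..<1} s *\<^sub>R f \<zeta> s = M} \<inter> {0..<1} = {s \<in> space \<zeta>. s < 1 \<and> f \<zeta> s = M}"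
    using YmeasD(2)[OF \<zeta>(1)] by (auto simp: indicator_def)
  have "{s \<in> space \<zeta>. s < 1 \<and> f \<zeta> s = M} \<subseteq> {0..1}" using YmeasD(2)[OF \<zeta>(1)] by blast
  then have "{s \<in> space \<zeta>. s < 1 \<and> f \<zeta> s = M} \<in> sets \<zeta>"
    using A unfolding E sets_Ymeas_iff[OF \<zeta>(1)] by blast
  from prob_Collect_eq_1[OF this]
  have iff: "measure \<zeta> {s \<in> space \<zeta>. s < 1 \<and> f \<zeta> s = M} = 1 \<longleftrightarrow> (AE s in \<zeta>. s < 1 \<and> f \<zeta> s = M)" .
  from AE_M have "AE s in \<zeta>. s < 1 \<and> f \<zeta> s = M" by (rule eventually_mono) (use q in auto)
  then have "concentrated_on_maximizers L d t \<beta> h b \<zeta>"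
    unfolding concentrated_on_maximizers_def W_def[symmetric] eq iff .
  with \<zeta>(1) show ?thesis by blast
qed

end

text \<open>Surjectivity of the mean resolvent is what makes the choice behind
  \<open>inv_into\<close> meaningful. The logarithm of the determinant splits because all factors
  are positive.\<close>

lemma K_torus_parisi:
  assumes "L \<ge> 1" "t > 0" "\<beta> > 0" "\<exists>\<epsilon>>0. summable (\<lambda>p. (b p)\<^sup>2 * (1 + \<epsilon>) ^ p)"
  obtains ls where "torus_parisi ls L d t \<beta> b"
proof -
  obtain ls where ls: "length ls = L ^ d" "0 \<in> set ls" "\<And>l. l \<in> set ls \<Longrightarrow> l \<ge> 0"
    and det: "\<And>u. u > 0 \<Longrightarrow> det (massive_laplacian L d t u) = (\<Prod>l\<leftarrow>ls. u + l)"
    and tr: "\<And>u. u > 0 \<Longrightarrow> resolvent_trace L d t u = (\<Sum>l\<leftarrow>ls. 1 / (u + l)) / real (L ^ d)"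
    using massive_laplacian_spectrum[OF assms(1,2)] by blast
  have R: "resolvent_trace L d t u = mean_resolvent ls u" if "u > 0" for u
    using tr[OF that] by (simp add: mean_resolvent_def ls(1))
  have inv: "K L d t x > 0 \<and> mean_resolvent ls (K L d t x) = x" if "x > 0" for x
  proof -
    have "x \<in> resolvent_trace L d t ` {0<..}"
      using mean_resolvent_surj[OF ls(2,3) that] R by force
    then show ?thesis
      using inv_into_into[of x "resolvent_trace L d t" "{0<..}"] f_inv_into_f[of x "resolvent_trace L d t" "{0<..}"] R
      unfolding K_def by auto
  qed
  have ln_prod: "ln (\<Prod>l\<leftarrow>xs. u + l) = (\<Sum>l\<leftarrow>xs. ln (u + l)) \<and> (\<Prod>l\<leftarrow>xs. u + l) > 0"
    if "u > 0" "\<And>l. l \<in> set xs \<Longrightarrow> l \<ge> 0" for u :: real and xs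
    using that(2)
  proof (induction xs)
    case (Cons a xs)
    have "u + a > 0" using Cons.prems[of a] that(1) by simp
    then show ?case using Cons by (simp add: ln_mult_pos)
  qed simp
  have "torus_parisi ls L d t \<beta> b"
  proof unfold_locales
    show "ls \<noteq> []" using ls(2) by auto
    show "ln (det (massive_laplacian L d t u)) = (\<Sum>l\<leftarrow>ls. ln (u + l))" if "u > 0" for u
      using det[OF that] ln_prod[OF that ls(3)] by simp
  qed (use ls inv assms continuous_on_xi' in auto)
  then show thesis by (rule that)
qed

theorem theorem1p14:
  fixes L d :: nat and t \<beta> h :: real and b :: "nat \<Rightarrow> real"
  assumes "L \<ge> 1" and "t > 0" and "\<beta> > 0"
    and "\<And>p. b p \<ge> 0"
    and "\<exists>\<epsilon>>0. summable (\<lambda>p. (b p)\<^sup>2 * (1 + \<epsilon>) ^ p)"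
  shows "strictly_convex_on_measures Ymeas (B_fun L d t \<beta> h b) \<and>
    (\<exists>\<zeta>c\<in>Ymeas.
       (\<forall>\<zeta>\<in>Ymeas. (\<forall>\<eta>\<in>Ymeas. B_fun L d t \<beta> h b \<zeta> \<le> B_fun L d t \<beta> h b \<eta>) \<longleftrightarrow> \<zeta> = \<zeta>c) \<and>
       (\<forall>\<zeta>\<in>Ymeas. concentrated_on_maximizers L d t \<beta> h b \<zeta> \<longleftrightarrow> \<zeta> = \<zeta>c))"
proof -
  obtain ls where "torus_parisi ls L d t \<beta> b" using K_torus_parisi[OF assms(1,2,3,5)] .
  then interpret torus_parisi ls L d t \<beta> h b .
  obtain \<zeta>c where c: "\<zeta>c \<in> Ymeas" "concentrated_on_maximizers L d t \<beta> h b \<zeta>c"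
    using exists_concentrated by blast
  have less: "B_fun L d t \<beta> h b \<zeta>c < B_fun L d t \<beta> h b \<zeta>" if "\<zeta> \<in> Ymeas" "\<zeta> \<noteq> \<zeta>c" for \<zeta>
    using concentrated_strict_minimizer[OF c(1) that(1) _ c(2)] that(2) by blast
  have "(\<forall>\<eta>\<in>Ymeas. B_fun L d t \<beta> h b \<zeta> \<le> B_fun L d t \<beta> h b \<eta>) \<longleftrightarrow> \<zeta> = \<zeta>c" if "\<zeta> \<in> Ymeas" for \<zeta>
  proof
    assume "\<forall>\<eta>\<in>Ymeas. B_fun L d t \<beta> h b \<zeta> \<le> B_fun L d t \<beta> h b \<eta>"
    then show "\<zeta> = \<zeta>c" using less[OF that] c(1) by force
  next
    assume "\<zeta> = \<zeta>c"
    then show "\<forall>\<eta>\<in>Ymeas. B_fun L d t \<beta> h b \<zeta> \<le> B_fun L d t \<beta> h b \<eta>"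
      using less by (metis less_imp_le order_refl)
  qed
  \<comment> \<open>Two distinct concentrated measures would each have a strictly smaller value than
    the other.\<close>
  moreover have "concentrated_on_maximizers L d t \<beta> h b \<zeta> \<longleftrightarrow> \<zeta> = \<zeta>c" if "\<zeta> \<in> Ymeas" for \<zeta>
    using less[OF that] concentrated_strict_minimizer[OF that c(1)] c(2) by fastforce
  ultimately show ?thesis using strictly_convex_B c(1) by blast
qed

end
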